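(* Let $G$ be a topological group and $S$ a closed subgroup of finite index in $G$. Then the universal minimal proximal flow $(S,\Pi(S))$ of $S$ can be extended to a flow $(G,\Pi(S))$ (that is, there is a jointly continuous action of $G$ on $\Pi(S)$ whose restriction to $S$ is the given action of $S$ on $\Pi(S)$) in such a way that the flows $(G,\Pi(G))$ and $(G,\Pi(S))$ are isomorphic. Also, $(G,\Pi(G))$ is free if and only if $(G,\Pi(S))$ is free.
   Context: A topological group is a group with a Hausdorff topology such that $(x,y)\mapsto xy^{-1}$ is continuous; $e$ is its neutral element. A flow $(G,X)$ consists of a topological group $G$ and a (nonempty) compact Hausdorff space $X$ with a jointly continuous action $G\times X\to X$, $(t,x)\mapsto tx$. Two flows of $G$ are isomorphic if there is a $G$-equivariant homeomorphism between them. A flow is free if $tx\ne x$ for every $x\in X$ and every $t\in G$ with $t\neq e$; minimal if every orbit is dense; proximal if for all $x,y\in X$ there is a net $\{t_n\}$ in $G$ with $\lim t_nx=\lim t_ny$. The universal minimal proximal flow $(G,\Pi(G))$ of a topological group $G$ is the minimal proximal flow, unique up to isomorphism, such that every minimal proximal flow $(G,Y)$ is the image of $\Pi(G)$ under a continuous surjective $G$-equivariant map (existence and uniqueness are known). $S$ carries the subspace topology. *)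

theory Defs
  imports "HOL-Analysis.Analysis" "HOL-Algebra.Group_Action"
begin

locale topological_group = group G
  for G :: "('a, 'm) monoid_scheme" (structure) and T :: "'a topology" +
  assumes topspace_eq_carrier: "topspace T = carrier G"
    and Hausdorff_group: "Hausdorff_space T"
    and continuous_mult_inv:
      "continuous_map (prod_topology T T) T (\<lambda>(x, y). x \<otimes> inv y)"

text \<open>The action is a library \<open>group_action\<close>, so every \<open>\<phi> t\<close> is an
  extensional bijection of \<open>topspace X\<close>.\<close>

locale flow = topological_group G T + group_action G "topspace X" \<phi>
  for G :: "('a, 'm) monoid_scheme" (structure) and T :: "'a topology"
    and X :: "'b topology" and \<phi> :: "'a \<Rightarrow> 'b \<Rightarrow> 'b" +
  assumes nonempty: "topspace X \<noteq> {}"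
    and compact: "compact_space X"
    and Hausdorff: "Hausdorff_space X"
    and jointly_continuous: "continuous_map (prod_topology T X) X (\<lambda>(t, x). \<phi> t x)"

definition flow_map ::
  "('a, 'm) monoid_scheme \<Rightarrow> 'b topology \<Rightarrow> ('a \<Rightarrow> 'b \<Rightarrow> 'b) \<Rightarrow>
   'c topology \<Rightarrow> ('a \<Rightarrow> 'c \<Rightarrow> 'c) \<Rightarrow> ('b \<Rightarrow> 'c) \<Rightarrow> bool" where
  "flow_map G X \<phi> Y \<psi> f \<longleftrightarrow> continuous_map X Y f \<and>
     (\<forall>t\<in>carrier G. \<forall>x\<in>topspace X. f (\<phi> t x) = \<psi> t (f x))"

definition isomorphic_flows ::
  "('a, 'm) monoid_scheme \<Rightarrow> 'b topology \<Rightarrow> ('a \<Rightarrow> 'b \<Rightarrow> 'b) \<Rightarrow>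
   'c topology \<Rightarrow> ('a \<Rightarrow> 'c \<Rightarrow> 'c) \<Rightarrow> bool" where
  "isomorphic_flows G X \<phi> Y \<psi> \<longleftrightarrow>
     (\<exists>f. flow_map G X \<phi> Y \<psi> f \<and> homeomorphic_map X Y f)"

locale free_flow = flow G T X \<phi>
  for G :: "('a, 'm) monoid_scheme" (structure) and T :: "'a topology"
    and X :: "'b topology" and \<phi> :: "'a \<Rightarrow> 'b \<Rightarrow> 'b" +
  assumes free: "\<lbrakk>x \<in> topspace X; t \<in> carrier G; t \<noteq> \<one>\<rbrakk> \<Longrightarrow> \<phi> t x \<noteq> x"

locale minimal_flow = flow G T X \<phi>
  for G :: "('a, 'm) monoid_scheme" (structure) and T :: "'a topology"
    and X :: "'b topology" and \<phi> :: "'a \<Rightarrow> 'b \<Rightarrow> 'b" +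
  assumes dense_orbit: "x \<in> topspace X \<Longrightarrow> X closure_of orbit G \<phi> x = topspace X"

text \<open>A net \<open>(t\<^sub>n)\<close> in \<open>G\<close> is rendered as a proper filter on \<open>G\<close> (the image under
  \<open>n \<mapsto> t\<^sub>n\<close> of the filter of tails); conversely every proper filter arises from a net
  in this way.\<close>

locale proximal_flow = flow G T X \<phi>
  for G :: "('a, 'm) monoid_scheme" (structure) and T :: "'a topology"
    and X :: "'b topology" and \<phi> :: "'a \<Rightarrow> 'b \<Rightarrow> 'b" +
  assumes proximal: "\<lbrakk>x \<in> topspace X; y \<in> topspace X\<rbrakk> \<Longrightarrow>
    \<exists>F z. F \<noteq> bot \<and> eventually (\<lambda>t. t \<in> carrier G) F \<and>
      limitin X (\<lambda>t. \<phi> t x) z F \<and> limitin X (\<lambda>t. \<phi> t y) z F"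

locale minimal_proximal_flow = minimal_flow G T X \<phi> + proximal_flow G T X \<phi>
  for G :: "('a, 'm) monoid_scheme" (structure) and T :: "'a topology"
    and X :: "'b topology" and \<phi> :: "'a \<Rightarrow> 'b \<Rightarrow> 'b"

text \<open>HOL cannot quantify over the type of the points of \<open>Y\<close> inside a definition. The points
  of a minimal flow of \<open>G\<close> can be encoded as sets of subsets of \<open>G\<close>, so it is enough to
  let \<open>Y\<close> range over the topologies on \<open>'a set set\<close>. The theorem
  \<open>universal_any_type\<close> below shows that this loses nothing: the same universal property
  follows for minimal proximal flows on an arbitrary type.\<close>

locale universal_minimal_proximal_flow = minimal_proximal_flow G T X \<phi>
  for G :: "('a, 'm) monoid_scheme" (structure) and T :: "'a topology"
    and X :: "'b topology" and \<phi> :: "'a \<Rightarrow> 'b \<Rightarrow> 'b" +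
  assumes universal:
    "minimal_proximal_flow G T (Y :: 'a set set topology) \<psi> \<Longrightarrow>
       \<exists>f. flow_map G X \<phi> Y \<psi> f \<and> f ` topspace X = topspace Y"


lemma minimal_proximal_flow_transport:
  fixes G :: "('a, 'm) monoid_scheme" (structure)
  assumes "minimal_proximal_flow G T X \<phi>" and "homeomorphic_maps X Y f g"
  shows "\<exists>\<psi>. minimal_proximal_flow G T Y \<psi> \<and> flow_map G Y \<psi> X \<phi> g"
proof -
  interpret minimal_proximal_flow G T X \<phi> by fact
  have cf: "continuous_map X Y f" and cg: "continuous_map Y X g"
    and gf: "\<And>x. x \<in> topspace X \<Longrightarrow> g (f x) = x"
    and fg: "\<And>y. y \<in> topspace Y \<Longrightarrow> f (g y) = y"
    using assms(2) by (auto simp: homeomorphic_maps_def)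
  have fX: "\<And>x. x \<in> topspace X \<Longrightarrow> f x \<in> topspace Y"
    using cf by (meson continuous_map_image_subset_topspace image_subset_iff)
  have gY: "\<And>y. y \<in> topspace Y \<Longrightarrow> g y \<in> topspace X"
    using cg by (meson continuous_map_image_subset_topspace image_subset_iff)
  have act: "\<And>t x. t \<in> carrier G \<Longrightarrow> x \<in> topspace X \<Longrightarrow> \<phi> t x \<in> topspace X"
    using element_image by blast
  have hom: "X homeomorphic_space Y"
    using assms(2) by (auto simp: homeomorphic_space_def)
  define \<psi> where "\<psi> t = (\<lambda>y\<in>topspace Y. f (\<phi> t (g y)))" for t
  have \<psi>Y: "\<And>t y. t \<in> carrier G \<Longrightarrow> y \<in> topspace Y \<Longrightarrow> \<psi> t y \<in> topspace Y"
    by (simp add: \<psi>_def fX act gY)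
  have \<psi>_mult: "\<psi> (s \<otimes> t) y = \<psi> s (\<psi> t y)"
    if "s \<in> carrier G" "t \<in> carrier G" "y \<in> topspace Y" for s t y
    using that composition_rule[of "g y" s t] by (simp add: \<psi>_def fX act gY gf)
  have \<psi>_one: "\<psi> \<one> y = y" if "y \<in> topspace Y" for y
    using that id_eq_one[symmetric] by (simp add: \<psi>_def gY fg)
  have \<psi>_bij: "\<psi> t \<in> Bij (topspace Y)" if t: "t \<in> carrier G" for t
  proof -
    have "bij_betw (\<psi> t) (topspace Y) (topspace Y)"
      by (rule bij_betw_byWitness[where f' = "\<psi> (inv t)"])
        (use t in \<open>auto simp: \<psi>Y \<psi>_mult[symmetric] \<psi>_one\<close>)
    then show ?thesis by (simp add: Bij_def \<psi>_def)
  qed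
  have "group_hom G (BijGroup (topspace Y)) \<psi>"
  proof (intro group_hom.intro group_hom_axioms.intro homI)
    show "group G" "group (BijGroup (topspace Y))"
      by (rule group_axioms, rule group_BijGroup)
    show "\<psi> t \<in> carrier (BijGroup (topspace Y))" if "t \<in> carrier G" for t
      using \<psi>_bij[OF that] by (simp add: BijGroup_def)
    show "\<psi> (s \<otimes> t) = \<psi> s \<otimes>\<^bsub>BijGroup (topspace Y)\<^esub> \<psi> t"
      if "s \<in> carrier G" "t \<in> carrier G" for s t
    proof
      fix y show "\<psi> (s \<otimes> t) y = (\<psi> s \<otimes>\<^bsub>BijGroup (topspace Y)\<^esub> \<psi> t) y"
        using that \<psi>_bij \<psi>_mult
        by (cases "y \<in> topspace Y") (auto simp: BijGroup_def compose_def \<psi>_def)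
    qed
  qed
  then have ga: "group_action G (topspace Y) \<psi>" by (rule group_action.intro)
  have "continuous_map (prod_topology T Y) (prod_topology T X) (\<lambda>p. (fst p, g (snd p)))"
    using cg by (intro continuous_map_pairedI continuous_map_fst)
      (auto intro: continuous_map_compose[OF continuous_map_snd cg, unfolded o_def])
  from continuous_map_compose[OF continuous_map_compose[OF this jointly_continuous] cf]
  have "continuous_map (prod_topology T Y) Y (\<lambda>(t, y). \<psi> t y)"
    by (rule continuous_map_eq) (auto simp: \<psi>_def)
  moreover have "topspace Y \<noteq> {}" using nonempty fX by blast
  ultimately have flow: "flow G T Y \<psi>"
    using ga compact Hausdorff topological_group_axioms
      homeomorphic_compact_space[OF hom] homeomorphic_Hausdorff_space[OF hom]
    by (auto intro!: flow.intro flow_axioms.intro)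
  have minimal: "minimal_flow G T Y \<psi>"
  proof (intro minimal_flow.intro minimal_flow_axioms.intro flow)
    fix y assume y: "y \<in> topspace Y"
    have "topspace Y = f ` topspace X"
      using fX gY fg by (metis image_eqI image_subsetI subsetI subset_antisym)
    also have "\<dots> = f ` (X closure_of orbit G \<phi> (g y))"
      using dense_orbit gY y by simp
    also have "\<dots> \<subseteq> Y closure_of f ` orbit G \<phi> (g y)"
      using cf by (simp add: continuous_map_image_closure_subset)
    also have "f ` orbit G \<phi> (g y) = orbit G \<psi> y"
      using y by (auto simp: orbit_def \<psi>_def)
    finally show "Y closure_of orbit G \<psi> y = topspace Y"
      by (simp add: closure_of_subset_topspace subset_antisym)
  qed
  have proximal: "proximal_flow G T Y \<psi>"
  proof (intro proximal_flow.intro proximal_flow_axioms.intro flow)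
    fix x y assume xy: "x \<in> topspace Y" "y \<in> topspace Y"
    then obtain F z where F: "F \<noteq> bot" "eventually (\<lambda>t. t \<in> carrier G) F"
      "limitin X (\<lambda>t. \<phi> t (g x)) z F" "limitin X (\<lambda>t. \<phi> t (g y)) z F"
      using proximal gY by meson
    have "limitin Y (\<lambda>t. \<psi> t x) (f z) F" "limitin Y (\<lambda>t. \<psi> t y) (f z) F"
      using continuous_map_limit[OF cf F(3)] continuous_map_limit[OF cf F(4)] xy
      by (simp_all add: \<psi>_def o_def)
    with F(1,2) show "\<exists>F z. F \<noteq> bot \<and> eventually (\<lambda>t. t \<in> carrier G) F \<and>
      limitin Y (\<lambda>t. \<psi> t x) z F \<and> limitin Y (\<lambda>t. \<psi> t y) z F" by blast
  qed
  have "flow_map G Y \<psi> X \<phi> g"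
    by (auto simp: flow_map_def cg \<psi>_def gf act gY)
  with minimal proximal show ?thesis
    by (blast intro: minimal_proximal_flow.intro)
qed

lemma (in minimal_flow) points_encodable:
  obtains j :: "'b \<Rightarrow> 'a set set" where "inj_on j (topspace X)"
proof -
  obtain x\<^sub>0 where x\<^sub>0: "x\<^sub>0 \<in> topspace X" using nonempty by blast
  define j where "j y = {A. A \<subseteq> carrier G \<and> y \<in> X closure_of ((\<lambda>t. \<phi> t x\<^sub>0) ` A)}" for y
  have "inj_on j (topspace X)"
  proof (rule inj_onI, rule ccontr)
    fix y z assume yz: "y \<in> topspace X" "z \<in> topspace X" "j y = j z" "y \<noteq> z"
    obtain U V where UV: "openin X U" "openin X V" "y \<in> U" "z \<in> V" "disjnt U V"
      using Hausdorff yz(1,2,4) unfolding Hausdorff_space_def by blast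
    define A where "A = {t \<in> carrier G. \<phi> t x\<^sub>0 \<in> U}"
    have "y \<in> X closure_of ((\<lambda>t. \<phi> t x\<^sub>0) ` A)"
      unfolding in_closure_of
    proof (intro conjI allI impI yz)
      fix W assume "y \<in> W \<and> openin X W"
      then have "openin X (U \<inter> W)" "y \<in> U \<inter> W" using UV by auto
      moreover have "y \<in> X closure_of orbit G \<phi> x\<^sub>0" using dense_orbit x\<^sub>0 yz by simp
      ultimately have "\<exists>w. w \<in> orbit G \<phi> x\<^sub>0 \<and> w \<in> U \<inter> W"
        unfolding in_closure_of by blast
      then show "\<exists>w. w \<in> (\<lambda>t. \<phi> t x\<^sub>0) ` A \<and> w \<in> W" by (auto simp: A_def orbit_def)
    qed
    then have "A \<in> j z" using yz by (auto simp: j_def A_def)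
    then obtain w where "w \<in> (\<lambda>t. \<phi> t x\<^sub>0) ` A" "w \<in> V"
      using UV unfolding j_def in_closure_of by blast
    then show False using UV by (auto simp: A_def disjnt_def)
  qed
  then show thesis by (rule that)
qed

theorem (in universal_minimal_proximal_flow) universal_any_type:
  fixes Y :: "'c topology"
  assumes "minimal_proximal_flow G T Y \<psi>"
  shows "\<exists>f. flow_map G X \<phi> Y \<psi> f \<and> f ` topspace X = topspace Y"
proof -
  interpret Y: minimal_proximal_flow G T Y \<psi> by fact
  obtain j :: "'c \<Rightarrow> 'a set set" where j: "inj_on j (topspace Y)"
    by (rule Y.points_encodable)
  define k where "k = inv_into (topspace Y) j"
  define Z where "Z = pullback_topology (j ` topspace Y) k Y"
  have kj: "\<And>y. y \<in> topspace Y \<Longrightarrow> k (j y) = y"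
    using j by (simp add: k_def)
  have Z: "topspace Z = j ` topspace Y"
    by (auto simp: Z_def topspace_pullback_topology kj)
  have ck: "continuous_map Z Y k"
    using continuous_map_pullback[OF continuous_map_id, of _ k Y]
    by (simp add: Z_def)
  have cj: "continuous_map Y Z j"
    unfolding Z_def
  proof (rule continuous_map_pullback')
    show "continuous_map Y Y (k \<circ> j)"
      by (rule continuous_map_eq[OF continuous_map_id]) (simp add: kj)
  qed auto
  have "homeomorphic_maps Y Z j k"
    using ck cj by (auto simp: homeomorphic_maps_def Z kj)
  then obtain \<zeta> where \<zeta>: "minimal_proximal_flow G T Z \<zeta>" "flow_map G Z \<zeta> Y \<psi> k"
    using minimal_proximal_flow_transport[OF assms] by blast
  then obtain f where f: "flow_map G X \<phi> Z \<zeta> f" "f ` topspace X = topspace Z"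
    using universal by blast
  have fX: "\<And>x. x \<in> topspace X \<Longrightarrow> f x \<in> topspace Z" using f(2) by blast
  have "flow_map G X \<phi> Y \<psi> (k \<circ> f)"
    using f(1) \<zeta>(2) fX by (auto simp: flow_map_def intro: continuous_map_compose)
  moreover have "(k \<circ> f) ` topspace X = topspace Y"
  proof -
    have "(k \<circ> f) ` topspace X = k ` j ` topspace Y"
      using f(2) Z by (metis image_comp)
    then show ?thesis using kj by (simp add: image_image)
  qed
  ultimately show ?thesis by blast
qed

end

(* Y is the universal flow of G, X that of S. Let N be the core of S in G, a normal subgroup of
   finite index. Proximality passes from G to N because finitely many translates of a closed
   N-invariant relation form a closed G-invariant one, and minimality passes to N because an
   N-minimal set meets, hence lies in, all its translates. So Y is a minimal proximal flow of S,
   and there is an S-map X -> Y. Conversely, the flow of G coinduced from X (the S-equivariant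
   maps G -> X) is proximal, so it has a minimal subflow that is a factor of Y, and evaluation at
   the unit gives an S-map Y -> X. S-endomorphisms of a minimal proximal flow are trivial, because
   their graphs meet the diagonal. Hence the two maps are mutually inverse, and the action of G on
   Y can be transported to X. *)

theory Submission
  imports Defs
begin

section \<open>Invariant sets and topological groups\<close>

text \<open>The two universal properties concern flows of different groups. Coinduction, the right
  adjoint of restriction from \<open>G\<close> to \<open>S\<close>, converts flows of
  \<open>S\<close> into flows of \<open>G\<close>, and evaluation at the unit is its counit. The
  core appears because \<open>S\<close> may fail to be normal: a translate \<open>g K\<close> of an
  \<open>S\<close>-invariant set is in general invariant only under a conjugate of \<open>S\<close>,
  and evaluating a coinduced point at \<open>g\<close> twists the action by conjugation with
  \<open>g\<close>. A set \<open>N\<close> closed under conjugation survives both. Proximality has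
  to descend before minimality, since it is what makes two closed \<open>N\<close>-invariant sets
  meet. The topology of \<open>G\<close> enters coinduction through the fact that a closed subgroup
  of finite index is open. To treat \<open>N\<close>, \<open>S\<close> and \<open>G\<close> alike,
  minimality and proximality are expressed by closed invariant subsets of \<open>X\<close> and of
  \<open>X \<times> X\<close>, for an arbitrary set \<open>H\<close> of acting elements, instead of
  by orbits and nets.\<close>

definition invariant_on :: "'a set \<Rightarrow> ('a \<Rightarrow> 'b \<Rightarrow> 'b) \<Rightarrow> 'b set \<Rightarrow> bool" where
  "invariant_on H \<phi> K \<longleftrightarrow> (\<forall>h\<in>H. \<phi> h ` K \<subseteq> K)"

definition minimal_on :: "'a set \<Rightarrow> 'b topology \<Rightarrow> ('a \<Rightarrow> 'b \<Rightarrow> 'b) \<Rightarrow> bool" where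
  "minimal_on H X \<phi> \<longleftrightarrow>
     (\<forall>K. closedin X K \<longrightarrow> K \<noteq> {} \<longrightarrow> invariant_on H \<phi> K \<longrightarrow> K = topspace X)"

text \<open>For a group \<open>H\<close>, the orbit closure of \<open>(x, y)\<close> is the least
  closed invariant relation containing that pair, and a net bringing \<open>x\<close> and
  \<open>y\<close> together is one that leads to a diagonal point of it.\<close>

definition proximal_on :: "'a set \<Rightarrow> 'b topology \<Rightarrow> ('a \<Rightarrow> 'b \<Rightarrow> 'b) \<Rightarrow> bool" where
  "proximal_on H X \<phi> \<longleftrightarrow>
     (\<forall>K. closedin (prod_topology X X) K \<longrightarrow> K \<noteq> {} \<longrightarrow>
       invariant_on H (\<lambda>h. map_prod (\<phi> h) (\<phi> h)) K \<longrightarrow> (\<exists>z. (z, z) \<in> K))"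

lemma minimal_on_mono: "minimal_on N X \<phi> \<Longrightarrow> N \<subseteq> H \<Longrightarrow> minimal_on H X \<phi>"
  unfolding minimal_on_def invariant_on_def by (meson subsetD)

lemma proximal_on_mono: "proximal_on N X \<phi> \<Longrightarrow> N \<subseteq> H \<Longrightarrow> proximal_on H X \<phi>"
  unfolding proximal_on_def invariant_on_def by (meson subsetD)

text \<open>Zorn's lemma; compactness keeps the intersection of a chain nonempty.\<close>

lemma minimal_closed_invariant:
  assumes "compact_space X" and L: "closedin X L" "L \<noteq> {}" "invariant_on H \<phi> L"
  obtains K where "closedin X K" "K \<noteq> {}" "K \<subseteq> L" "invariant_on H \<phi> K"
    "\<And>K'. closedin X K' \<Longrightarrow> K' \<noteq> {} \<Longrightarrow> K' \<subseteq> K \<Longrightarrow> invariant_on H \<phi> K' \<Longrightarrow> K' = K"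
proof -
  define P where "P K \<longleftrightarrow> closedin X K \<and> K \<noteq> {} \<and> K \<subseteq> L \<and> invariant_on H \<phi> K" for K
  \<comment> \<open>Minimal sets are obtained as complements of maximal ones. The complement is
    taken in the whole type, so that double complements cancel.\<close>
  have "\<exists>M\<in>{U. P (- U)}. \<forall>U\<in>{U. P (- U)}. M \<subseteq> U \<longrightarrow> U = M"
  proof (rule subset_Zorn_nonempty)
    have "P (- (- L))" using L by (simp add: P_def)
    then show "{U. P (- U)} \<noteq> {}" by blast
    fix \<C> assume ne: "\<C> \<noteq> {}" and "subset.chain {U. P (- U)} \<C>"
    then have PC: "\<And>U. U \<in> \<C> \<Longrightarrow> P (- U)"
      and lin: "\<And>U V. U \<in> \<C> \<Longrightarrow> V \<in> \<C> \<Longrightarrow> U \<subseteq> V \<or> V \<subseteq> U"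
      by (auto simp: subset_chain_def)
    \<comment> \<open>A chain is directed, which yields the finite intersection property of the
      complements; the empty family is covered because the chain is nonempty.\<close>
    have bound: "\<exists>U\<in>\<C>. \<Union>\<F> \<subseteq> U" if "finite \<F>" "\<F> \<subseteq> \<C>" for \<F>
      using that
    proof (induction \<F>)
      case empty
      then show ?case using ne by auto
    next
      case (insert V \<F>)
      then obtain U where "U \<in> \<C>" "\<Union>\<F> \<subseteq> U" by auto
      then show ?case using insert.prems lin[of U V] by auto
    qed
    have "\<Inter>(uminus ` \<C>) \<noteq> {}"
    proof -
      have "\<forall>C\<in>uminus ` \<C>. closedin X C" using PC by (auto simp: P_def)
      moreover have "\<Inter>\<F> \<noteq> {}" if \<F>: "finite \<F>" "\<F> \<subseteq> uminus ` \<C>" for \<F>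
      proof -
        have "\<exists>\<F>'\<subseteq>\<C>. finite \<F>' \<and> \<F> = uminus ` \<F>'"
          by (rule finite_subset_image[OF \<F>])
        then obtain \<F>' where \<F>': "\<F>' \<subseteq> \<C>" "finite \<F>'" "\<F> = uminus ` \<F>'"
          by (elim exE conjE)
        obtain U where U: "U \<in> \<C>" "\<Union>\<F>' \<subseteq> U" using bound[OF \<F>'(2,1)] by (elim bexE)
        have "- U \<subseteq> \<Inter>\<F>" using U(2) unfolding \<F>'(3) by fast
        moreover have "- U \<noteq> {}" using PC[OF U(1)] unfolding P_def by (elim conjE)
        ultimately show ?thesis by (metis subset_empty)
      qed
      ultimately show ?thesis
        using assms(1)[unfolded compact_space_fip, THEN spec, THEN mp, of "uminus ` \<C>"]
        by simp
    qed
    moreover have "closedin X (\<Inter>(uminus ` \<C>))"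
      using PC ne by (intro closedin_Inter) (auto simp: P_def)
    moreover have "\<Inter>(uminus ` \<C>) \<subseteq> L" using PC ne by (auto simp: P_def)
    moreover have "invariant_on H \<phi> (\<Inter>(uminus ` \<C>))"
      using PC unfolding P_def invariant_on_def by (auto simp: image_subset_iff)
    moreover have "- \<Union>\<C> = \<Inter>(uminus ` \<C>)" by auto
    ultimately show "\<Union>\<C> \<in> {U. P (- U)}" by (simp add: P_def)
  qed
  then obtain M where M: "P (- M)" "\<And>U. P (- U) \<Longrightarrow> M \<subseteq> U \<Longrightarrow> U = M" by blast
  show thesis
  proof (rule that[of "- M"])
    fix K' assume K': "closedin X K'" "K' \<noteq> {}" "K' \<subseteq> - M" "invariant_on H \<phi> K'"
    then have "P (- (- K'))" using M(1) by (auto simp: P_def)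
    then show "K' = - M" using M(2)[of "- K'"] K'(3) by blast
  qed (use M(1) in \<open>auto simp: P_def\<close>)
qed

text \<open>Bijectivity comes from the action laws, with \<open>\<phi> (inv t)\<close> as inverse.
  Elements of \<open>BijGroup\<close> are extensional, which is why \<open>ext\<close>
  appears.\<close>

lemma group_actionI:
  assumes "group G"
    and maps: "\<And>t x. t \<in> carrier G \<Longrightarrow> x \<in> E \<Longrightarrow> \<phi> t x \<in> E"
    and mult: "\<And>s t x. s \<in> carrier G \<Longrightarrow> t \<in> carrier G \<Longrightarrow> x \<in> E \<Longrightarrow>
      \<phi> (s \<otimes>\<^bsub>G\<^esub> t) x = \<phi> s (\<phi> t x)"
    and one: "\<And>x. x \<in> E \<Longrightarrow> \<phi> \<one>\<^bsub>G\<^esub> x = x"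
    and ext: "\<And>t. t \<in> carrier G \<Longrightarrow> \<phi> t \<in> extensional E"
  shows "group_action G E \<phi>"
proof -
  interpret group G by fact
  have bij: "\<phi> t \<in> Bij E" if t: "t \<in> carrier G" for t
  proof -
    have "bij_betw (\<phi> t) E E"
      by (rule bij_betw_byWitness[where f' = "\<phi> (inv\<^bsub>G\<^esub> t)"])
        (use t in \<open>auto simp: maps mult[symmetric] one\<close>)
    then show ?thesis using ext[OF t] by (simp add: Bij_def)
  qed
  have "\<phi> (s \<otimes>\<^bsub>G\<^esub> t) = \<phi> s \<otimes>\<^bsub>BijGroup E\<^esub> \<phi> t" if st: "s \<in> carrier G" "t \<in> carrier G" for s t
  proof -
    have "\<phi> (s \<otimes>\<^bsub>G\<^esub> t) x = compose E (\<phi> s) (\<phi> t) x" for x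
      using st mult ext[of "s \<otimes>\<^bsub>G\<^esub> t"]
      by (cases "x \<in> E") (auto simp: compose_def extensional_def)
    then show ?thesis using bij st by (auto simp: BijGroup_def)
  qed
  then have "\<phi> \<in> hom G (BijGroup E)"
    using bij by (intro homI) (auto simp: BijGroup_def)
  then show ?thesis
    by (simp add: group_action_def group_hom_def group_hom_axioms_def group_BijGroup group_axioms)
qed

section \<open>Translations and subgroups of topological groups\<close>

context topological_group
begin

lemma continuous_map_translation:
  assumes "g \<in> carrier G" "h \<in> carrier G"
  shows "continuous_map T T (\<lambda>t. g \<otimes> t \<otimes> h)"
proof -
  have right: "continuous_map T T (\<lambda>t. t \<otimes> a)" if "a \<in> carrier G" for a
  proof -
    have "continuous_map T (prod_topology T T) (\<lambda>t. (t, inv a))"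
      using that by (intro continuous_intros) (simp_all add: topspace_eq_carrier)
    from continuous_map_compose[OF this continuous_mult_inv] show ?thesis
      using that by (simp add: o_def)
  qed
  have sub: "continuous_map T T (\<lambda>t. a \<otimes> inv t)" if "a \<in> carrier G" for a
  proof -
    have "continuous_map T (prod_topology T T) (\<lambda>t. (a, t))"
      using that by (intro continuous_intros) (simp_all add: topspace_eq_carrier)
    from continuous_map_compose[OF this continuous_mult_inv] show ?thesis
      by (simp add: o_def)
  qed
  \<comment> \<open>Left translation is written as two maps of the form
    \<open>a \<otimes> inv t\<close>, the form that the continuity axiom provides.\<close>
  have "continuous_map T T (\<lambda>t. g \<otimes> inv (\<one> \<otimes> inv t))"
    using continuous_map_compose[OF sub[OF one_closed] sub[OF assms(1)]] by (simp add: o_def)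
  then have "continuous_map T T (\<lambda>t. g \<otimes> t)"
    by (rule continuous_map_eq) (simp add: topspace_eq_carrier)
  from continuous_map_compose[OF this right[OF assms(2)]] show ?thesis by (simp add: o_def)
qed

text \<open>The complement is the finite union of the other cosets, each closed as the preimage of
  \<open>S\<close> under a right translation.\<close>

lemma openin_finite_index_subgroup:
  assumes "subgroup S G" "closedin T S" "finite (rcosets S)"
  shows "openin T S"
proof -
  interpret S: subgroup S G by fact
  have clo: "closedin T K" if K: "K \<in> rcosets S" for K
  proof -
    obtain g where g: "g \<in> carrier G" "K = S #> g"
      using K by (auto simp: RCOSETS_def)
    have "K = {t \<in> topspace T. \<one> \<otimes> t \<otimes> inv g \<in> S}"
    proof (intro equalityI subsetI)
      fix t assume "t \<in> K"
      then obtain s where "s \<in> S" "t = s \<otimes> g" using g by (auto simp: r_coset_def)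
      then show "t \<in> {t \<in> topspace T. \<one> \<otimes> t \<otimes> inv g \<in> S}"
        using g S.subset by (auto simp: topspace_eq_carrier m_assoc)
    next
      fix t assume "t \<in> {t \<in> topspace T. \<one> \<otimes> t \<otimes> inv g \<in> S}"
      then have "t \<in> carrier G" "t \<otimes> inv g \<in> S"
        using g(1) by (auto simp: topspace_eq_carrier)
      moreover from this have "(t \<otimes> inv g) \<otimes> g = t" using g by (simp add: m_assoc)
      ultimately show "t \<in> K" unfolding g(2) r_coset_def by blast
    qed
    then show ?thesis
      using closedin_continuous_map_preimage[OF continuous_map_translation assms(2)] g by simp
  qed
  have "S \<in> rcosets S"
    using rcosetsI[OF S.subset one_closed] by (simp add: coset_mult_one S.subset)
  then have "\<And>K. K \<in> rcosets S \<Longrightarrow> K \<noteq> S \<Longrightarrow> K \<inter> S = {}"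
    using rcos_disjoint[OF assms(1)] unfolding pairwise_def disjnt_def by blast
  then have "topspace T - S = \<Union>(rcosets S - {S})"
    unfolding topspace_eq_carrier rcosets_part_G[OF assms(1), symmetric] by blast
  then have "closedin T (topspace T - S)"
    using clo assms(3) by (auto intro!: closedin_Union)
  then show ?thesis
    using S.subset by (simp add: openin_closedin_eq topspace_eq_carrier)
qed

lemma subgroup_topological_group:
  assumes "subgroup S G"
  shows "topological_group (G\<lparr>carrier := S\<rparr>) (subtopology T S)"
proof (intro topological_group.intro topological_group_axioms.intro)
  interpret S: subgroup S G by fact
  show "group (G\<lparr>carrier := S\<rparr>)" by (rule S.subgroup_is_group[OF group_axioms])
  show "topspace (subtopology T S) = carrier (G\<lparr>carrier := S\<rparr>)"
    using S.subset by (auto simp: topspace_eq_carrier)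
  show "Hausdorff_space (subtopology T S)" by (rule Hausdorff_space_subtopology[OF Hausdorff_group])
  have "continuous_map (prod_topology (subtopology T S) (subtopology T S)) (subtopology T S)
     (\<lambda>(x, y). x \<otimes> inv y)"
    using continuous_map_from_subtopology[OF continuous_mult_inv, of "S \<times> S"]
    by (auto simp: subtopology_Times continuous_map_in_subtopology)
  then show "continuous_map (prod_topology (subtopology T S) (subtopology T S)) (subtopology T S)
     (\<lambda>(x, y). x \<otimes>\<^bsub>G\<lparr>carrier := S\<rparr>\<^esub> inv\<^bsub>G\<lparr>carrier := S\<rparr>\<^esub> y)"
    by (rule continuous_map_eq) (auto simp: m_inv_consistent[OF assms])
qed

end

text \<open>\<open>N\<close> is the kernel of the action of the group on the cosets of
  \<open>S\<close> by right translation. Only finitely many self-maps of the finite coset set exist,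
  so finitely many elements \<open>C\<close> realize every \<open>r g\<close>, and elements inducing
  the same map differ by a factor in \<open>N\<close>.\<close>

lemma (in group) finite_index_core:
  assumes S: "subgroup S G" and fin: "finite (rcosets S)"
  obtains N C where "N \<subseteq> S" "\<And>g n. g \<in> carrier G \<Longrightarrow> n \<in> N \<Longrightarrow> g \<otimes> n \<otimes> inv g \<in> N"
    "finite C" "C \<subseteq> carrier G" "\<And>g. g \<in> carrier G \<Longrightarrow> \<exists>c\<in>C. \<exists>n\<in>N. g = c \<otimes> n"
proof -
  interpret S: subgroup S G by fact
  define N where "N = {n \<in> carrier G. \<forall>g\<in>carrier G. g \<otimes> n \<otimes> inv g \<in> S}"
  define r where "r g = (\<lambda>K\<in>rcosets S. K #> inv g)" for g
  have "r ` carrier G \<subseteq> (\<Pi>\<^sub>E K\<in>rcosets S. rcosets S)"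
  proof -
    have "K #> inv g \<in> rcosets S" if K: "K \<in> rcosets S" and g: "g \<in> carrier G" for K g
    proof -
      obtain x where "x \<in> carrier G" "K = S #> x" using K by (auto simp: RCOSETS_def)
      then show ?thesis
        using g S.subset by (auto simp: coset_mult_assoc intro!: rcosetsI)
    qed
    then show ?thesis by (auto simp: r_def)
  qed
  then have "finite (r ` carrier G)"
    by (rule finite_subset) (simp add: finite_PiE fin)
  then obtain C where C: "C \<subseteq> carrier G" "finite C" "r ` carrier G = r ` C"
    by (metis finite_subset_image order_refl)
  show thesis
  proof (rule that[of N C])
    have "n \<in> S" if "n \<in> N" for n
    proof -
      have "\<one> \<otimes> n \<otimes> inv \<one> \<in> S" "n \<in> carrier G" using that unfolding N_def by blast+
      then show ?thesis by simp
    qed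
    then show "N \<subseteq> S" by blast
    show "g \<otimes> n \<otimes> inv g \<in> N" if g: "g \<in> carrier G" and n: "n \<in> N" for g n
    proof -
      have nG: "n \<in> carrier G" using n by (simp add: N_def)
      have "h \<otimes> (g \<otimes> n \<otimes> inv g) \<otimes> inv h \<in> S" if h: "h \<in> carrier G" for h
      proof -
        have "(h \<otimes> g) \<otimes> n \<otimes> inv (h \<otimes> g) \<in> S" using n g h by (simp add: N_def)
        then show ?thesis using g h nG by (simp add: inv_mult_group m_assoc)
      qed
      then show ?thesis using g nG by (simp add: N_def)
    qed
    show "\<exists>c\<in>C. \<exists>n\<in>N. g = c \<otimes> n" if g: "g \<in> carrier G" for g
    proof -
      obtain c where c: "c \<in> C" "r c = r g" using C g by (metis image_iff)
      have cG: "c \<in> carrier G" using c C by blast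
      \<comment> \<open>Comparing \<open>r c\<close> and \<open>r g\<close> at the coset
        \<open>S #> x\<close> gives exactly the membership for conjugation by
        \<open>x\<close>.\<close>
      have "x \<otimes> (inv c \<otimes> g) \<otimes> inv x \<in> S" if x: "x \<in> carrier G" for x
      proof -
        have "S #> x \<in> rcosets S" using x S.subset by (simp add: rcosetsI)
        then have "(S #> x) #> inv c = (S #> x) #> inv g"
          using c(2) by (metis r_def restrict_apply')
        then have "S #> (x \<otimes> inv c) = S #> (x \<otimes> inv g)"
          using x cG g S.subset by (simp add: coset_mult_assoc)
        then have "x \<otimes> inv c \<in> S #> (x \<otimes> inv g)"
          using rcos_self[OF _ S, of "x \<otimes> inv c"] x cG by simp
        then obtain s where s: "s \<in> S" "x \<otimes> inv c = s \<otimes> (x \<otimes> inv g)"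
          by (auto simp: r_coset_def)
        have "x \<otimes> (inv c \<otimes> g) \<otimes> inv x = (x \<otimes> inv c) \<otimes> (g \<otimes> inv x)"
          using x cG g by (simp add: m_assoc)
        also have "\<dots> = (s \<otimes> (x \<otimes> inv g)) \<otimes> inv (x \<otimes> inv g)"
          using s(2) x g by (simp add: inv_mult_group)
        also have "\<dots> = s" using subsetD[OF S.subset s(1)] x g by (subst m_assoc) auto
        finally show ?thesis using s by simp
      qed
      then have "inv c \<otimes> g \<in> N" using cG g by (simp add: N_def)
      moreover have "g = c \<otimes> (inv c \<otimes> g)" using cG g by (simp add: m_assoc[symmetric])
      ultimately show ?thesis using c by blast
    qed
  qed (use C in auto)
qed

section \<open>Minimality and proximality along subgroups\<close>

context flow
begin

lemma action_in [simp]: "t \<in> carrier G \<Longrightarrow> x \<in> topspace X \<Longrightarrow> \<phi> t x \<in> topspace X"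
  using element_image by blast

lemma action_one [simp]: "x \<in> topspace X \<Longrightarrow> \<phi> \<one> x = x"
  using id_eq_one[symmetric] by simp

lemma action_inv [simp]:
  assumes "t \<in> carrier G" "x \<in> topspace X"
  shows "\<phi> (inv t) (\<phi> t x) = x" "\<phi> t (\<phi> (inv t) x) = x"
  using assms composition_rule[of x "inv t" t] composition_rule[of x t "inv t"] by auto

lemma continuous_map_action:
  assumes "t \<in> carrier G"
  shows "continuous_map X X (\<phi> t)"
proof -
  have "continuous_map X (prod_topology T X) (\<lambda>x. (t, x))"
    using assms by (intro continuous_intros) (simp_all add: topspace_eq_carrier)
  from continuous_map_compose[OF this jointly_continuous] show ?thesis by (simp add: o_def)
qed

lemma continuous_map_diagonal_action:
  assumes "t \<in> carrier G"
  shows "continuous_map (prod_topology X X) (prod_topology X X) (map_prod (\<phi> t) (\<phi> t))"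
  using continuous_map_compose[OF continuous_map_fst[of X X] continuous_map_action[OF assms]]
    continuous_map_compose[OF continuous_map_snd[of X X] continuous_map_action[OF assms]]
  by (simp add: continuous_map_pairwise o_def)

lemma square_compact: "compact_space (prod_topology X X)"
  and square_Hausdorff: "Hausdorff_space (prod_topology X X)"
  using compact Hausdorff by (auto simp: compact_space_prod_topology Hausdorff_space_prod_topology)

lemma invariant_closure:
  assumes "H \<subseteq> carrier G" "A \<subseteq> topspace X" "invariant_on H \<phi> A"
  shows "invariant_on H \<phi> (X closure_of A)"
  unfolding invariant_on_def
proof
  fix h assume h: "h \<in> H"
  have "\<phi> h ` (X closure_of A) \<subseteq> X closure_of \<phi> h ` A"
    using continuous_map_action h assms(1) by (intro continuous_map_image_closure_subset) auto
  also have "\<dots> \<subseteq> X closure_of A"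
    using assms(3) h by (intro closure_of_mono) (auto simp: invariant_on_def)
  finally show "\<phi> h ` (X closure_of A) \<subseteq> X closure_of A" .
qed

text \<open>A closed invariant set contains the orbit closure of each of its points, and an orbit
  closure is itself closed and invariant.\<close>

lemma minimal_flow_iff: "minimal_flow G T X \<phi> \<longleftrightarrow> minimal_on (carrier G) X \<phi>"
proof
  assume "minimal_flow G T X \<phi>"
  then interpret minimal_flow G T X \<phi> .
  show "minimal_on (carrier G) X \<phi>"
    unfolding minimal_on_def
  proof (intro allI impI)
    fix K assume K: "closedin X K" "K \<noteq> {}" "invariant_on (carrier G) \<phi> K"
    then obtain x where x: "x \<in> K" by blast
    then have "orbit G \<phi> x \<subseteq> K" using K(3) by (auto simp: orbit_def invariant_on_def)
    then have "X closure_of orbit G \<phi> x \<subseteq> K" using K(1) by (simp add: closure_of_minimal)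
    then show "K = topspace X"
      using dense_orbit x closedin_subset[OF K(1)] by blast
  qed
next
  assume min: "minimal_on (carrier G) X \<phi>"
  show "minimal_flow G T X \<phi>"
  proof (intro minimal_flow.intro minimal_flow_axioms.intro flow_axioms)
    fix x assume x: "x \<in> topspace X"
    have orb: "orbit G \<phi> x \<subseteq> topspace X" "x \<in> orbit G \<phi> x"
      using x orbit_refl by (auto simp: orbit_def)
    have "invariant_on (carrier G) \<phi> (orbit G \<phi> x)"
      using x by (auto simp: invariant_on_def orbit_def composition_rule[symmetric])
    with orb have "invariant_on (carrier G) \<phi> (X closure_of orbit G \<phi> x)"
      by (intro invariant_closure) auto
    moreover have "X closure_of orbit G \<phi> x \<noteq> {}"
      using orb closure_of_subset by fastforce
    ultimately show "X closure_of orbit G \<phi> x = topspace X"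
      using min by (simp add: minimal_on_def)
  qed
qed

text \<open>A closed invariant relation contains the limits of the nets in it; conversely, the orbit
  closure of \<open>(x, y)\<close> contains a diagonal point, which orbit points
  approximate.\<close>

lemma proximal_flow_iff: "proximal_flow G T X \<phi> \<longleftrightarrow> proximal_on (carrier G) X \<phi>"
proof
  assume "proximal_flow G T X \<phi>"
  then interpret proximal_flow G T X \<phi> .
  show "proximal_on (carrier G) X \<phi>"
    unfolding proximal_on_def
  proof (intro allI impI)
    fix K assume K: "closedin (prod_topology X X) K" "K \<noteq> {}"
      "invariant_on (carrier G) (\<lambda>h. map_prod (\<phi> h) (\<phi> h)) K"
    then obtain x y where xy: "(x, y) \<in> K" by auto
    then have "x \<in> topspace X" "y \<in> topspace X"
      using closedin_subset[OF K(1)] by auto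
    then obtain F z where F: "F \<noteq> bot" "eventually (\<lambda>t. t \<in> carrier G) F"
      "limitin X (\<lambda>t. \<phi> t x) z F" "limitin X (\<lambda>t. \<phi> t y) z F"
      using proximal by blast
    have "limitin (prod_topology X X) (\<lambda>t. (\<phi> t x, \<phi> t y)) (z, z) F"
      using F by (simp add: limitin_pairwise o_def)
    moreover have "\<forall>\<^sub>F t in F. (\<phi> t x, \<phi> t y) \<in> K"
      using F(2) by (rule eventually_mono) (use K(3) xy in \<open>force simp: invariant_on_def\<close>)
    ultimately have "(z, z) \<in> K"
      using limitin_closedin[OF _ K(1)] F(1) by blast
    then show "\<exists>z. (z, z) \<in> K" ..
  qed
next
  assume prox: "proximal_on (carrier G) X \<phi>"
  show "proximal_flow G T X \<phi>"
  proof (intro proximal_flow.intro proximal_flow_axioms.intro flow_axioms)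
    fix x y assume xy: "x \<in> topspace X" "y \<in> topspace X"
    let ?p = "\<lambda>t. (\<phi> t x, \<phi> t y)"
    let ?Q = "prod_topology X X"
    define K where "K = ?Q closure_of (?p ` carrier G)"
    have sub: "?p ` carrier G \<subseteq> topspace ?Q" using xy by auto
    then have "K \<noteq> {}" using closure_of_subset[OF sub] one_closed by (auto simp: K_def)
    moreover have "invariant_on (carrier G) (\<lambda>h. map_prod (\<phi> h) (\<phi> h)) K"
      unfolding invariant_on_def
    proof
      fix h assume h: "h \<in> carrier G"
      have "map_prod (\<phi> h) (\<phi> h) ` K \<subseteq> ?Q closure_of map_prod (\<phi> h) (\<phi> h) ` ?p ` carrier G"
        unfolding K_def
        by (rule continuous_map_image_closure_subset[OF continuous_map_diagonal_action[OF h]])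
      also have "\<dots> \<subseteq> K"
        unfolding K_def
        using h xy by (intro closure_of_mono) (auto simp: composition_rule[symmetric])
      finally show "map_prod (\<phi> h) (\<phi> h) ` K \<subseteq> K" .
    qed
    ultimately have "\<exists>z. (z, z) \<in> K"
      using prox closedin_closure_of[of ?Q "?p ` carrier G"] unfolding proximal_on_def K_def by blast
    then obtain z where z: "(z, z) \<in> K" ..
    \<comment> \<open>The preimages of the neighbourhoods of \<open>(z, z)\<close>, cut down to the
      group. This filter is proper because every such neighbourhood meets the orbit of
      \<open>(x, y)\<close>.\<close>
    define F where "F = inf (filtercomap ?p (nhdsin ?Q (z, z))) (principal (carrier G))"
    have zX: "z \<in> topspace X" using z by (auto simp: K_def in_closure_of)
    have "F \<noteq> bot"
    proof
      assume "F = bot"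
      then have "eventually (\<lambda>t. False) F" by simp
      then obtain P where P: "eventually P (nhdsin ?Q (z, z))"
        and out: "\<And>t. t \<in> carrier G \<Longrightarrow> \<not> P (?p t)"
        by (auto simp: F_def eventually_inf_principal eventually_filtercomap)
      obtain U where U: "openin ?Q U" "(z, z) \<in> U" "\<And>q. q \<in> U \<Longrightarrow> P q"
        using P zX by (auto simp: eventually_nhdsin)
      then obtain q where "q \<in> ?p ` carrier G" "q \<in> U"
        using z unfolding K_def in_closure_of by blast
      then show False using U(3) out by auto
    qed
    moreover have "eventually (\<lambda>t. t \<in> carrier G) F"
      by (simp add: F_def eventually_inf_principal)
    moreover have "limitin ?Q ?p (z, z) F"
      unfolding limitin_def
    proof (intro conjI allI impI)
      fix U assume "openin ?Q U \<and> (z, z) \<in> U"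
      then have "eventually (\<lambda>q. q \<in> U) (nhdsin ?Q (z, z))"
        using zX by (auto simp: eventually_nhdsin)
      then show "\<forall>\<^sub>F t in F. ?p t \<in> U"
        unfolding F_def eventually_inf_principal
        by (auto simp: eventually_filtercomap)
    qed (simp add: zX)
    then have "limitin X (\<lambda>t. \<phi> t x) z F" "limitin X (\<lambda>t. \<phi> t y) z F"
      by (simp_all add: limitin_pairwise o_def)
    ultimately show "\<exists>F z. F \<noteq> bot \<and> eventually (\<lambda>t. t \<in> carrier G) F \<and>
      limitin X (\<lambda>t. \<phi> t x) z F \<and> limitin X (\<lambda>t. \<phi> t y) z F" by blast
  qed
qed

lemma subflow:
  assumes M: "closedin X M" "M \<noteq> {}" "invariant_on (carrier G) \<phi> M"
  shows "flow G T (subtopology X M) (\<lambda>t. restrict (\<phi> t) M)"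
proof -
  have MX: "M \<subseteq> topspace X" using M(1) by (rule closedin_subset)
  then have top: "topspace (subtopology X M) = M" by auto
  have inv: "\<And>t x. t \<in> carrier G \<Longrightarrow> x \<in> M \<Longrightarrow> \<phi> t x \<in> M"
    using M(3) by (auto simp: invariant_on_def)
  show ?thesis
  proof (intro flow.intro flow_axioms.intro topological_group_axioms)
    show "group_action G (topspace (subtopology X M)) (\<lambda>t. restrict (\<phi> t) M)"
      unfolding top using MX
      by (intro group_actionI group_axioms) (auto simp: inv composition_rule subset_iff)
    have "continuous_map (prod_topology T (subtopology X M)) X (\<lambda>(t, x). \<phi> t x)"
      unfolding prod_topology_subtopology
      by (rule continuous_map_from_subtopology[OF jointly_continuous])
    then have "continuous_map (prod_topology T (subtopology X M)) X (\<lambda>(t, x). restrict (\<phi> t) M x)"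
      by (rule continuous_map_eq) (auto simp: top)
    then show "continuous_map (prod_topology T (subtopology X M)) (subtopology X M)
        (\<lambda>(t, x). restrict (\<phi> t) M x)"
      by (rule continuous_map_into_subtopology) (auto simp: inv topspace_eq_carrier)
    show "topspace (subtopology X M) \<noteq> {}" unfolding top by (rule M(2))
    show "compact_space (subtopology X M)"
      by (rule compact_space_subtopology[OF closedin_compact_space[OF compact M(1)]])
    show "Hausdorff_space (subtopology X M)" by (rule Hausdorff_space_subtopology[OF Hausdorff])
  qed
qed

lemma subgroup_flow:
  assumes "subgroup S G"
  shows "flow (G\<lparr>carrier := S\<rparr>) (subtopology T S) X \<phi>"
proof (intro flow.intro flow_axioms.intro subgroup_topological_group assms nonempty compact Hausdorff)
  interpret S: subgroup S G by fact
  show "group_action (G\<lparr>carrier := S\<rparr>) (topspace X) \<phi>"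
    using S.subset S.subgroup_is_group[OF group_axioms] bij_prop0
    by (intro group_actionI) (auto simp: composition_rule subset_iff Bij_def)
  show "continuous_map (prod_topology (subtopology T S) X) X (\<lambda>(t, x). \<phi> t x)"
    unfolding prod_topology_subtopology
    by (rule continuous_map_from_subtopology[OF jointly_continuous])
qed

end

section \<open>Descent to normal sets of finite index and to subflows\<close>

context flow
begin

text \<open>Serves twice: for \<open>G\<close> itself, and with \<open>S\<close> as the ambient
  group and the representatives that lie in \<open>S\<close>.\<close>

lemma proximal_on_finite_index:
  assumes prox: "proximal_on (carrier G) X \<phi>" and N: "N \<subseteq> carrier G"
    and C: "finite C" "C \<subseteq> carrier G" "\<And>g. g \<in> carrier G \<Longrightarrow> \<exists>c\<in>C. \<exists>n\<in>N. g = c \<otimes> n"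
  shows "proximal_on N X \<phi>"
  unfolding proximal_on_def
proof (intro allI impI)
  let ?a = "\<lambda>t. map_prod (\<phi> t) (\<phi> t)"
  fix K assume K: "closedin (prod_topology X X) K" "K \<noteq> {}" "invariant_on N ?a K"
  \<comment> \<open>Invariant under all of \<open>G\<close>: write
    \<open>g \<otimes> c = c' \<otimes> n\<close> and let \<open>n\<close> be absorbed by
    \<open>K\<close>.\<close>
  define L where "L = (\<Union>c\<in>C. ?a c ` K)"
  have KX: "K \<subseteq> topspace X \<times> topspace X" using closedin_subset[OF K(1)] by simp
  have "closedin (prod_topology X X) (?a c ` K)" if "c \<in> C" for c
    using that C(2) closedin_compact_space[OF square_compact K(1)]
    by (intro compactin_imp_closedin[OF square_Hausdorff]
        image_compactin[OF _ continuous_map_diagonal_action]) auto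
  then have "closedin (prod_topology X X) L"
    unfolding L_def using C(1) by (intro closedin_Union) auto
  moreover have "L \<noteq> {}"
    using K(2) C(3)[OF one_closed] by (auto simp: L_def)
  moreover have "invariant_on (carrier G) ?a L"
    unfolding invariant_on_def
  proof (intro ballI subsetI)
    fix g q assume g: "g \<in> carrier G" and "q \<in> ?a g ` L"
    then obtain c k where c: "c \<in> C" and k: "k \<in> K" and q: "q = ?a g (?a c k)"
      by (auto simp: L_def)
    have cG: "c \<in> carrier G" using c C(2) by blast
    obtain c' n where c': "c' \<in> C" "n \<in> N" "g \<otimes> c = c' \<otimes> n"
      using C(3)[of "g \<otimes> c"] g cG by auto
    have kX: "fst k \<in> topspace X" "snd k \<in> topspace X" using k KX by auto
    have G: "c' \<in> carrier G" "n \<in> carrier G" using c' C(2) N by auto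
    have "\<phi> g (\<phi> c x) = \<phi> c' (\<phi> n x)" if "x \<in> topspace X" for x
      using that c'(3) g cG G composition_rule[of x g c] composition_rule[of x c' n] by simp
    then have "q = ?a c' (?a n k)" using kX unfolding q by (simp add: map_prod_def split_beta)
    moreover have "?a n k \<in> K" using K(3) c'(2) k by (auto simp: invariant_on_def)
    ultimately show "q \<in> L" using c'(1) by (auto simp: L_def)
  qed
  ultimately have "\<exists>z. (z, z) \<in> L" using prox unfolding proximal_on_def by blast
  then obtain z c x y where "c \<in> C" "(x, y) \<in> K" "z = \<phi> c x" "z = \<phi> c y"
    by (auto simp: L_def)
  \<comment> \<open>Injectivity of \<open>\<phi> c\<close> pulls the diagonal point of a translate
    back into \<open>K\<close>.\<close>
  moreover from this have "x = y" using KX C(2) inj_prop[of c] by (auto dest: inj_onD)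
  ultimately show "\<exists>z. (z, z) \<in> K" by blast
qed

text \<open>Any two closed \<open>N\<close>-invariant sets meet by proximality, so an \<open>N\<close>-minimal set \<open>K\<close> lies in
  each of its translates \<open>g K\<close>, which are \<open>N\<close>-invariant because \<open>N\<close> is normal.\<close>

lemma minimal_on_normal:
  assumes min: "minimal_on (carrier G) X \<phi>" and prox: "proximal_on N X \<phi>" and N: "N \<subseteq> carrier G"
    and conj: "\<And>g n. g \<in> carrier G \<Longrightarrow> n \<in> N \<Longrightarrow> g \<otimes> n \<otimes> inv g \<in> N"
  shows "minimal_on N X \<phi>"
  unfolding minimal_on_def
proof (intro allI impI)
  fix L assume L: "closedin X L" "L \<noteq> {}" "invariant_on N \<phi> L"
  obtain K where K: "closedin X K" "K \<noteq> {}" "K \<subseteq> L" "invariant_on N \<phi> K"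
    and least: "\<And>K'. closedin X K' \<Longrightarrow> K' \<noteq> {} \<Longrightarrow> K' \<subseteq> K \<Longrightarrow> invariant_on N \<phi> K' \<Longrightarrow> K' = K"
    using minimal_closed_invariant[OF compact L] by metis
  have KX: "K \<subseteq> topspace X" using closedin_subset[OF K(1)] .
  have translate: "K \<subseteq> \<phi> g ` K" if g: "g \<in> carrier G" for g
  proof -
    have clo: "closedin X (\<phi> g ` K)"
      using closedin_compact_space[OF compact K(1)] g
      by (intro compactin_imp_closedin[OF Hausdorff] image_compactin[OF _ continuous_map_action])
    have inv: "invariant_on N \<phi> (\<phi> g ` K)"
      unfolding invariant_on_def
    proof (intro ballI subsetI)
      fix n y assume n: "n \<in> N" and "y \<in> \<phi> n ` \<phi> g ` K"
      then obtain x where x: "x \<in> K" "y = \<phi> n (\<phi> g x)" by auto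
      have nG: "n \<in> carrier G" and xX: "x \<in> topspace X" using n N x(1) KX by auto
      \<comment> \<open>Moving \<open>n\<close> past \<open>g\<close> replaces it by a conjugate,
        which stays in \<open>N\<close>.\<close>
      have m: "inv g \<otimes> n \<otimes> g \<in> N" using conj[of "inv g" n] g n by simp
      have mG: "inv g \<otimes> n \<otimes> g \<in> carrier G" using g nG by simp
      have "g \<otimes> (inv g \<otimes> n \<otimes> g) = n \<otimes> g" using g nG by (simp add: m_assoc[symmetric])
      then have "y = \<phi> g (\<phi> (inv g \<otimes> n \<otimes> g) x)"
        using x(2) composition_rule[OF xX g mG] composition_rule[OF xX nG g] by simp
      moreover have "\<phi> (inv g \<otimes> n \<otimes> g) x \<in> K"
        using K(4) m x(1) by (auto simp: invariant_on_def)
      ultimately show "y \<in> \<phi> g ` K" by blast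
    qed
    \<comment> \<open>A diagonal point of this product relation is a common point of the two
      sets.\<close>
    have "closedin (prod_topology X X) (K \<times> \<phi> g ` K)"
      using clo K(1) by (simp add: closedin_prod_Times_iff)
    moreover have "invariant_on N (\<lambda>h. map_prod (\<phi> h) (\<phi> h)) (K \<times> \<phi> g ` K)"
      using K(4) inv unfolding invariant_on_def by (auto simp: image_subset_iff)
    ultimately have "\<exists>z. (z, z) \<in> K \<times> \<phi> g ` K"
      using prox K(2) unfolding proximal_on_def by blast
    then have "K \<inter> \<phi> g ` K \<noteq> {}" by blast
    moreover have "invariant_on N \<phi> (K \<inter> \<phi> g ` K)"
      using K(4) inv unfolding invariant_on_def by blast
    ultimately have "K \<inter> \<phi> g ` K = K"
      using clo K(1) by (intro least) auto
    then show ?thesis by blast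
  qed
  \<comment> \<open>The inclusion \<open>translate\<close> for \<open>inv g\<close> is the reverse
    inclusion for \<open>g\<close>.\<close>
  have "invariant_on (carrier G) \<phi> K"
    unfolding invariant_on_def
  proof (intro ballI subsetI)
    fix g y assume g: "g \<in> carrier G" and "y \<in> \<phi> g ` K"
    then obtain x where x: "x \<in> K" "y = \<phi> g x" by blast
    then obtain x' where "x' \<in> K" "x = \<phi> (inv g) x'" using translate[of "inv g"] g by blast
    then show "y \<in> K" using x(2) g KX by auto
  qed
  then show "L = topspace X"
    using min K closedin_subset[OF L(1)] unfolding minimal_on_def by blast
qed

lemma minimal_proximal_flow_iff:
  "minimal_proximal_flow G T X \<phi> \<longleftrightarrow>
     minimal_on (carrier G) X \<phi> \<and> proximal_on (carrier G) X \<phi>"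
  using minimal_flow_iff proximal_flow_iff by (auto simp: minimal_proximal_flow_def)

text \<open>Proximality passes to any closed invariant \<open>M\<close>, because a closed relation
  on \<open>M\<close> is closed in the square of \<open>X\<close>; minimality is the choice of
  \<open>M\<close>.\<close>

lemma minimal_proximal_subflow:
  assumes "proximal_on (carrier G) X \<phi>"
  obtains M where "M \<subseteq> topspace X"
    "minimal_proximal_flow G T (subtopology X M) (\<lambda>t. restrict (\<phi> t) M)"
proof -
  have "invariant_on (carrier G) \<phi> (topspace X)" by (auto simp: invariant_on_def)
  then obtain M where M: "closedin X M" "M \<noteq> {}" "M \<subseteq> topspace X" "invariant_on (carrier G) \<phi> M"
    and least: "\<And>K. closedin X K \<Longrightarrow> K \<noteq> {} \<Longrightarrow> K \<subseteq> M \<Longrightarrow> invariant_on (carrier G) \<phi> K \<Longrightarrow> K = M"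
    using minimal_closed_invariant[OF compact closedin_topspace nonempty] by metis
  let ?M = "subtopology X M" and ?\<mu> = "\<lambda>t. restrict (\<phi> t) M"
  interpret M: flow G T ?M ?\<mu> by (rule subflow[OF M(1,2,4)])
  have top: "topspace ?M = M" using M(3) by auto
  have "minimal_on (carrier G) ?M ?\<mu>"
    unfolding minimal_on_def top
  proof (intro allI impI)
    fix K assume K: "closedin ?M K" "K \<noteq> {}" "invariant_on (carrier G) ?\<mu> K"
    then have "closedin X K" "K \<subseteq> M" using closedin_closed_subtopology[OF M(1)] by auto
    moreover from this have "invariant_on (carrier G) \<phi> K"
      using K(3) by (auto simp: invariant_on_def image_subset_iff subset_iff)
    ultimately show "K = M" using K(2) least by blast
  qed
  moreover have "proximal_on (carrier G) ?M ?\<mu>"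
    unfolding proximal_on_def
  proof (intro allI impI)
    fix K assume K: "closedin (prod_topology ?M ?M) K" "K \<noteq> {}"
      "invariant_on (carrier G) (\<lambda>h. map_prod (?\<mu> h) (?\<mu> h)) K"
    have KM: "K \<subseteq> M \<times> M" using closedin_subset[OF K(1)] top by simp
    have "closedin (prod_topology X X) (M \<times> M)" using M(1) by (simp add: closedin_prod_Times_iff)
    with K(1) have clo: "closedin (prod_topology X X) K"
      unfolding subtopology_Times[symmetric] by (rule closedin_trans_full)
    have "invariant_on (carrier G) (\<lambda>h. map_prod (\<phi> h) (\<phi> h)) K"
      unfolding invariant_on_def
    proof (intro ballI subsetI)
      fix h q assume h: "h \<in> carrier G" and "q \<in> map_prod (\<phi> h) (\<phi> h) ` K"
      then obtain x y where xy: "(x, y) \<in> K" "q = (\<phi> h x, \<phi> h y)" by auto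
      then have "map_prod (?\<mu> h) (?\<mu> h) (x, y) \<in> K" using K(3) h unfolding invariant_on_def by blast
      then show "q \<in> K" using xy KM by auto
    qed
    then show "\<exists>z. (z, z) \<in> K" using assms clo K(2) unfolding proximal_on_def by blast
  qed
  ultimately have "minimal_proximal_flow G T ?M ?\<mu>" by (simp add: M.minimal_proximal_flow_iff)
  with M(3) show thesis by (rule that)
qed

end

section \<open>Rigidity of minimal proximal flows\<close>

context minimal_proximal_flow
begin

text \<open>Proximality, applied to the graph, yields just one fixed point. The fixed points form a
  closed invariant set, so minimality spreads this to all of \<open>X\<close>.\<close>

lemma flow_map_self_eq_id:
  assumes f: "flow_map G X \<phi> X \<phi> f" and x: "x \<in> topspace X"
  shows "f x = x"
proof -
  have cf: "continuous_map X X f" and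
    eq: "\<And>t x. t \<in> carrier G \<Longrightarrow> x \<in> topspace X \<Longrightarrow> f (\<phi> t x) = \<phi> t (f x)"
    using f by (auto simp: flow_map_def)
  have min: "minimal_on (carrier G) X \<phi>" and prox: "proximal_on (carrier G) X \<phi>"
    using minimal_proximal_flow_iff minimal_proximal_flow_axioms by auto
  have fX: "\<And>x. x \<in> topspace X \<Longrightarrow> f x \<in> topspace X"
    using continuous_map_image_subset_topspace[OF cf] by blast
  let ?gr = "(\<lambda>x. (x, f x)) ` topspace X"
  have "compactin (prod_topology X X) ?gr"
    using compact cf by (intro image_compactin[of X]) (auto simp: compact_space_def intro!: continuous_intros)
  then have "closedin (prod_topology X X) ?gr"
    by (rule compactin_imp_closedin[OF square_Hausdorff])
  moreover have "invariant_on (carrier G) (\<lambda>h. map_prod (\<phi> h) (\<phi> h)) ?gr"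
    unfolding invariant_on_def by (auto simp: eq[symmetric])
  moreover have "?gr \<noteq> {}" using nonempty by simp
  ultimately have "\<exists>z. (z, z) \<in> ?gr" using prox unfolding proximal_on_def by blast
  then have "{x \<in> topspace X. f x = x} \<noteq> {}" by force
  moreover have "closedin X {x \<in> topspace X. f x = x}"
    by (rule closedin_continuous_maps_eq[OF Hausdorff cf continuous_map_id[unfolded id_def]])
  moreover have "invariant_on (carrier G) \<phi> {x \<in> topspace X. f x = x}"
    by (auto simp: invariant_on_def eq)
  ultimately have "{x \<in> topspace X. f x = x} = topspace X"
    using min unfolding minimal_on_def by blast
  then show ?thesis using x by blast
qed

end

section \<open>The coinduced flow\<close>

text \<open>Openness of \<open>S\<close> is what joint continuity of the coinduced action rests on;
  finiteness of the index enters later, with proximality.\<close>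

locale open_subgroup_flow = topological_group G T +
  S: flow "G\<lparr>carrier := S\<rparr>" "subtopology T S" X \<phi>
  for G :: "('a, 'm) monoid_scheme" (structure) and T :: "'a topology" and S :: "'a set"
    and X :: "'b topology" and \<phi> :: "'a \<Rightarrow> 'b \<Rightarrow> 'b" +
  assumes subgroup: "subgroup S G" and "open": "openin T S"
begin

sublocale sub: subgroup S G by (rule subgroup)

text \<open>Equivariance determines \<open>f\<close> on a coset \<open>S g\<close> from its value at
  \<open>g\<close>. As \<open>S\<close> is open, such maps are automatically continuous, so the
  product topology on all functions is the right ambient space.\<close>

definition coinduced_space :: "('a \<Rightarrow> 'b) topology" where
  "coinduced_space = subtopology (product_topology (\<lambda>_. X) (carrier G))
     {f. \<forall>s\<in>S. \<forall>g\<in>carrier G. f (s \<otimes> g) = \<phi> s (f g)}"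

text \<open>Translating the argument on the right gives a left action and commutes with the
  equivariance condition, which concerns left factors.\<close>

definition coinduced_action :: "'a \<Rightarrow> ('a \<Rightarrow> 'b) \<Rightarrow> 'a \<Rightarrow> 'b" where
  "coinduced_action t = (\<lambda>f\<in>topspace coinduced_space. \<lambda>g\<in>carrier G. f (g \<otimes> t))"

lemma topspace_coinduced_iff:
  "f \<in> topspace coinduced_space \<longleftrightarrow>
     f \<in> (\<Pi>\<^sub>E g\<in>carrier G. topspace X) \<and> (\<forall>s\<in>S. \<forall>g\<in>carrier G. f (s \<otimes> g) = \<phi> s (f g))"
  by (auto simp: coinduced_space_def)

lemma coinduced_equivariant:
  "f \<in> topspace coinduced_space \<Longrightarrow> s \<in> S \<Longrightarrow> g \<in> carrier G \<Longrightarrow> f (s \<otimes> g) = \<phi> s (f g)"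
  by (simp add: topspace_coinduced_iff)

lemma coinduced_apply_in:
  "f \<in> topspace coinduced_space \<Longrightarrow> g \<in> carrier G \<Longrightarrow> f g \<in> topspace X"
  by (auto simp: topspace_coinduced_iff)

lemma coinduced_action_apply:
  "f \<in> topspace coinduced_space \<Longrightarrow> g \<in> carrier G \<Longrightarrow> coinduced_action t f g = f (g \<otimes> t)"
  by (simp add: coinduced_action_def)

lemma coinduced_action_in:
  assumes "t \<in> carrier G" "f \<in> topspace coinduced_space"
  shows "coinduced_action t f \<in> topspace coinduced_space"
  unfolding topspace_coinduced_iff
proof (intro conjI ballI)
  show "coinduced_action t f \<in> (\<Pi>\<^sub>E g\<in>carrier G. topspace X)"
    using assms by (auto simp: coinduced_action_def coinduced_apply_in)
  fix s g assume "s \<in> S" "g \<in> carrier G"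
  then show "coinduced_action t f (s \<otimes> g) = \<phi> s (coinduced_action t f g)"
    using assms by (simp add: coinduced_action_apply m_assoc coinduced_equivariant)
qed

lemma continuous_map_evaluation:
  "g \<in> carrier G \<Longrightarrow> continuous_map coinduced_space X (\<lambda>f. f g)"
  unfolding coinduced_space_def
  by (intro continuous_map_from_subtopology continuous_map_product_projection)

lemma coinduced_compact: "compact_space coinduced_space"
  and coinduced_Hausdorff: "Hausdorff_space coinduced_space"
proof -
  let ?P = "product_topology (\<lambda>_. X) (carrier G)"
  define E where "E s g = {f \<in> topspace ?P. f (s \<otimes> g) = \<phi> s (f g)}" for s g
  have "closedin ?P (E s g)" if "s \<in> S" "g \<in> carrier G" for s g
    unfolding E_def
  proof (rule closedin_continuous_maps_eq[OF S.Hausdorff])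
    show "continuous_map ?P X (\<lambda>f. f (s \<otimes> g))"
      using that by (intro continuous_map_product_projection) simp
    have "continuous_map ?P X (\<lambda>f. f g)"
      using that by (intro continuous_map_product_projection)
    from continuous_map_compose[OF this S.continuous_map_action]
    show "continuous_map ?P X (\<lambda>f. \<phi> s (f g))" using that by (simp add: o_def)
  qed
  moreover have ne: "S \<times> carrier G \<noteq> {}" using sub.one_closed one_closed by blast
  ultimately have "closedin ?P (\<Inter>(s, g)\<in>S \<times> carrier G. E s g)"
    by (intro closedin_Inter) auto
  moreover have "(\<Inter>(s, g)\<in>S \<times> carrier G. E s g) = topspace coinduced_space"
    using ne unfolding coinduced_space_def E_def by auto
  ultimately have clo: "closedin ?P (topspace coinduced_space)" by simp
  have "coinduced_space = subtopology ?P (topspace coinduced_space)"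
    unfolding coinduced_space_def topspace_subtopology by (rule subtopology_restrict[symmetric])
  moreover have "compact_space ?P"
    using S.compact by (simp add: compact_space_product_topology)
  ultimately show "compact_space coinduced_space"
    using clo by (metis closedin_compact_space compact_space_subtopology)
  show "Hausdorff_space coinduced_space"
    unfolding coinduced_space_def
    by (intro Hausdorff_space_subtopology) (simp add: Hausdorff_space_product_topology S.Hausdorff)
qed

lemma coinduced_nonempty: "topspace coinduced_space \<noteq> {}"
proof -
  obtain x where x: "x \<in> topspace X" using S.nonempty by blast
  \<comment> \<open>A representative that depends only on the coset \<open>S #> g\<close>. The point
    built from it is the equivariant map with value \<open>x\<close> at every
    representative.\<close>
  define r where "r g = (SOME r. r \<in> S #> g)" for g
  have r: "r g \<in> carrier G" "g \<otimes> inv (r g) \<in> S" if g: "g \<in> carrier G" for g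
  proof -
    have "r g \<in> S #> g"
      unfolding r_def by (rule someI) (rule rcos_self[OF g subgroup])
    then obtain s where s: "s \<in> S" "r g = s \<otimes> g" by (auto simp: r_coset_def)
    show "r g \<in> carrier G" using s g by simp
    have "g \<otimes> inv (r g) = inv s" using s g by (simp add: inv_mult_group m_assoc[symmetric])
    then show "g \<otimes> inv (r g) \<in> S" using s by simp
  qed
  have r_eq: "r (s \<otimes> g) = r g" if "s \<in> S" "g \<in> carrier G" for s g
  proof -
    have "S #> (s \<otimes> g) = (S #> s) #> g"
      using that sub.subset by (simp add: coset_mult_assoc)
    also have "S #> s = S" using that by (intro coset_join2[OF _ subgroup]) auto
    finally show ?thesis by (simp add: r_def)
  qed
  have "(\<lambda>g\<in>carrier G. \<phi> (g \<otimes> inv (r g)) x) \<in> topspace coinduced_space"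
    unfolding topspace_coinduced_iff
  proof (intro conjI ballI)
    show "(\<lambda>g\<in>carrier G. \<phi> (g \<otimes> inv (r g)) x) \<in> (\<Pi>\<^sub>E g\<in>carrier G. topspace X)"
      using r x by auto
    fix s g assume sg: "s \<in> S" "g \<in> carrier G"
    have "\<phi> (s \<otimes> (g \<otimes> inv (r g))) x = \<phi> s (\<phi> (g \<otimes> inv (r g)) x)"
      using S.composition_rule[of x s "g \<otimes> inv (r g)"] x sg r by simp
    then show "(\<lambda>g\<in>carrier G. \<phi> (g \<otimes> inv (r g)) x) (s \<otimes> g) =
        \<phi> s ((\<lambda>g\<in>carrier G. \<phi> (g \<otimes> inv (r g)) x) g)"
      using sg r by (simp add: r_eq m_assoc)
  qed
  then show ?thesis by blast
qed

text \<open>Near \<open>h\<close> the evaluation \<open>f (g \<otimes> t)\<close> equals the jointly continuous expression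
  \<open>\<phi> (g \<otimes> t \<otimes> inv (g \<otimes> h)) (f (g \<otimes> h))\<close>, because \<open>S\<close> is open.\<close>

lemma coinduced_jointly_continuous:
  "continuous_map (prod_topology T coinduced_space) coinduced_space
     (\<lambda>(t, f). coinduced_action t f)"
proof -
  let ?Q = "prod_topology T coinduced_space"
  \<comment> \<open>The piece for \<open>h\<close> consists of the \<open>t\<close> for which
    \<open>g \<otimes> t\<close> lies in the coset of \<open>g \<otimes> h\<close>.\<close>
  have coord: "continuous_map ?Q X (\<lambda>(t, f). f (g \<otimes> t))" if g: "g \<in> carrier G" for g
  proof (rule pasting_lemma[where I = "carrier G"
        and T = "\<lambda>h. {t \<in> topspace T. g \<otimes> t \<otimes> inv (g \<otimes> h) \<in> S} \<times> topspace coinduced_space"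
        and f = "\<lambda>h (t, f). \<phi> (g \<otimes> t \<otimes> inv (g \<otimes> h)) (f (g \<otimes> h))"])
    have agree: "\<phi> (g \<otimes> t \<otimes> inv (g \<otimes> h)) (f (g \<otimes> h)) = f (g \<otimes> t)"
      if "h \<in> carrier G" "t \<in> carrier G" "g \<otimes> t \<otimes> inv (g \<otimes> h) \<in> S"
        "f \<in> topspace coinduced_space" for h t f
    proof -
      have "(g \<otimes> t \<otimes> inv (g \<otimes> h)) \<otimes> (g \<otimes> h) = g \<otimes> t"
        using that(1,2) g by (simp add: m_assoc del: inv_mult_group)
      then show ?thesis using coinduced_equivariant[OF that(4,3), of "g \<otimes> h"] that(1) g by simp
    qed
    fix h assume h: "h \<in> carrier G"
    let ?U = "{t \<in> topspace T. g \<otimes> t \<otimes> inv (g \<otimes> h) \<in> S}"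
    have trans: "continuous_map T T (\<lambda>t. g \<otimes> t \<otimes> inv (g \<otimes> h))"
      using g h by (intro continuous_map_translation) auto
    show "openin ?Q (?U \<times> topspace coinduced_space)"
      using openin_continuous_map_preimage[OF trans "open"] by (simp add: openin_prod_Times_iff)
    have "continuous_map (subtopology T ?U) (subtopology T S) (\<lambda>t. g \<otimes> t \<otimes> inv (g \<otimes> h))"
      using continuous_map_from_subtopology[OF trans] by (auto simp: continuous_map_in_subtopology)
    from continuous_map_compose[OF continuous_map_fst this]
      continuous_map_compose[OF continuous_map_snd continuous_map_evaluation[of "g \<otimes> h"]]
    have "continuous_map (prod_topology (subtopology T ?U) coinduced_space)
        (prod_topology (subtopology T S) X)
        (\<lambda>p. (g \<otimes> fst p \<otimes> inv (g \<otimes> h), snd p (g \<otimes> h)))"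
      using g h by (intro continuous_map_pairedI) (simp_all add: o_def)
    from continuous_map_compose[OF this S.jointly_continuous]
    show "continuous_map (subtopology ?Q (?U \<times> topspace coinduced_space)) X
        (\<lambda>(t, f). \<phi> (g \<otimes> t \<otimes> inv (g \<otimes> h)) (f (g \<otimes> h)))"
      by (simp add: prod_topology_subtopology(1)[symmetric] o_def case_prod_unfold)
    fix h' p assume h': "h' \<in> carrier G"
      and "p \<in> topspace ?Q \<inter> (?U \<times> topspace coinduced_space) \<inter>
        ({t \<in> topspace T. g \<otimes> t \<otimes> inv (g \<otimes> h') \<in> S} \<times> topspace coinduced_space)"
    then show "(\<lambda>(t, f). \<phi> (g \<otimes> t \<otimes> inv (g \<otimes> h)) (f (g \<otimes> h))) p =
        (\<lambda>(t, f). \<phi> (g \<otimes> t \<otimes> inv (g \<otimes> h')) (f (g \<otimes> h'))) p"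
      using agree[OF h] agree[OF h'] by (auto simp: topspace_eq_carrier)
  next
    fix p assume "p \<in> topspace ?Q"
    then obtain t f where p: "p = (t, f)" "t \<in> carrier G" "f \<in> topspace coinduced_space"
      by (auto simp: topspace_eq_carrier)
    \<comment> \<open>The piece for \<open>h = t\<close> contains the given point, so the pieces
      cover.\<close>
    have "g \<otimes> t \<otimes> inv (g \<otimes> t) = \<one>" using p(2) g by simp
    moreover have "\<phi> \<one> (f (g \<otimes> t)) = f (g \<otimes> t)"
      using S.action_one coinduced_apply_in p g by simp
    ultimately have "t \<in> carrier G \<and>
        p \<in> {t' \<in> topspace T. g \<otimes> t' \<otimes> inv (g \<otimes> t) \<in> S} \<times> topspace coinduced_space \<and>
        (case p of (t, f) \<Rightarrow> f (g \<otimes> t)) =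
        (case p of (t', f) \<Rightarrow> \<phi> (g \<otimes> t' \<otimes> inv (g \<otimes> t)) (f (g \<otimes> t)))"
      using p by (simp add: topspace_eq_carrier)
    then show "\<exists>h. h \<in> carrier G \<and>
        p \<in> {t \<in> topspace T. g \<otimes> t \<otimes> inv (g \<otimes> h) \<in> S} \<times> topspace coinduced_space \<and>
        (case p of (t, f) \<Rightarrow> f (g \<otimes> t)) =
        (case p of (t, f) \<Rightarrow> \<phi> (g \<otimes> t \<otimes> inv (g \<otimes> h)) (f (g \<otimes> h)))" ..
  qed
  have into: "(\<lambda>(t, f). coinduced_action t f) p \<in> topspace coinduced_space"
    if "p \<in> topspace ?Q" for p
    using that coinduced_action_in by (auto simp: topspace_eq_carrier)
  have "continuous_map ?Q (product_topology (\<lambda>_. X) (carrier G)) (\<lambda>(t, f). coinduced_action t f)"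
    unfolding continuous_map_componentwise
  proof (intro conjI ballI)
    show "(\<lambda>(t, f). coinduced_action t f) ` topspace ?Q \<subseteq> extensional (carrier G)"
      using into unfolding topspace_coinduced_iff by (auto simp: PiE_def)
    fix g assume g: "g \<in> carrier G"
    show "continuous_map ?Q X (\<lambda>p. (\<lambda>(t, f). coinduced_action t f) p g)"
      by (rule continuous_map_eq[OF coord[OF g]])
        (auto simp: coinduced_action_apply[OF _ g])
  qed
  then show ?thesis
    using into unfolding coinduced_space_def
    by (intro continuous_map_into_subtopology) auto
qed

lemma coinduced_flow: "flow G T coinduced_space coinduced_action"
proof (intro flow.intro flow_axioms.intro topological_group_axioms coinduced_nonempty
    coinduced_compact coinduced_Hausdorff coinduced_jointly_continuous group_actionI group_axioms)
  fix s t f assume st: "s \<in> carrier G" "t \<in> carrier G" and f: "f \<in> topspace coinduced_space"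
  show "coinduced_action (s \<otimes> t) f = coinduced_action s (coinduced_action t f)"
  proof
    fix g show "coinduced_action (s \<otimes> t) f g = coinduced_action s (coinduced_action t f) g"
      using st f coinduced_action_in[OF st(2) f]
      by (cases "g \<in> carrier G") (auto simp: coinduced_action_def m_assoc)
  qed
next
  fix f assume f: "f \<in> topspace coinduced_space"
  show "coinduced_action \<one> f = f"
  proof
    fix g show "coinduced_action \<one> f g = f g"
      using f unfolding topspace_coinduced_iff
      by (cases "g \<in> carrier G")
        (auto simp: coinduced_action_def f PiE_def extensional_def)
  qed
qed (auto simp: coinduced_action_in, simp add: coinduced_action_def)

text \<open>A nonempty closed invariant relation on the coinduced space can be shrunk so that its pairs
  agree at one more element of \<open>G\<close>; equivariance turns agreement at representatives of all cosets
  of \<open>S\<close> into equality.\<close>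

lemma coinduced_proximal:
  assumes prox: "proximal_on N X \<phi>" and N: "N \<subseteq> S"
    and conj: "\<And>g n. g \<in> carrier G \<Longrightarrow> n \<in> N \<Longrightarrow> g \<otimes> n \<otimes> inv g \<in> N"
    and R: "finite R" "R \<subseteq> carrier G" "\<And>g. g \<in> carrier G \<Longrightarrow> \<exists>s\<in>S. \<exists>r\<in>R. g = s \<otimes> r"
  shows "proximal_on (carrier G) coinduced_space coinduced_action"
  unfolding proximal_on_def
proof (intro allI impI)
  interpret Z: flow G T coinduced_space coinduced_action by (rule coinduced_flow)
  let ?Z = "coinduced_space" and ?a = "\<lambda>t. map_prod (coinduced_action t) (coinduced_action t)"
  let ?ev = "\<lambda>g. map_prod (\<lambda>f. f g) (\<lambda>f. f g)"
  fix K assume K: "closedin (prod_topology ?Z ?Z) K" "K \<noteq> {}" "invariant_on (carrier G) ?a K"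
  have NG: "N \<subseteq> carrier G" using N sub.subset by blast
  \<comment> \<open>Evaluation at \<open>g\<close> turns \<open>n\<close> into its conjugate by
    \<open>g\<close>; normality keeps that conjugate in \<open>N\<close>, where proximality of
    \<open>X\<close> is available.\<close>
  have ev_action: "coinduced_action n f g = \<phi> (g \<otimes> n \<otimes> inv g) (f g)"
    if "n \<in> N" "g \<in> carrier G" "f \<in> topspace ?Z" for n g f
  proof -
    have n: "n \<in> carrier G" using that(1) NG by blast
    have m: "g \<otimes> n \<otimes> inv g \<in> S" using conj[OF that(2,1)] N by blast
    have "(g \<otimes> n \<otimes> inv g) \<otimes> g = g \<otimes> n" using that(2) n by (simp add: m_assoc)
    then show ?thesis
      using coinduced_equivariant[OF that(3) m that(2)] coinduced_action_apply[OF that(3,2)]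
      by simp
  qed
  have cont_ev: "continuous_map (prod_topology ?Z ?Z) (prod_topology X X) (?ev g)"
    if "g \<in> carrier G" for g
    using continuous_map_compose[OF continuous_map_fst[of ?Z ?Z] continuous_map_evaluation[OF that]]
      continuous_map_compose[OF continuous_map_snd[of ?Z ?Z] continuous_map_evaluation[OF that]]
    by (simp add: continuous_map_pairwise o_def)
  have "\<exists>p\<in>K. \<forall>r\<in>R'. fst p r = snd p r" if "finite R'" "R' \<subseteq> carrier G" for R'
    using that
  proof (induction R')
    case empty
    then show ?case using K(2) by auto
  next
    case (insert g R')
    then have g: "g \<in> carrier G" and R': "R' \<subseteq> carrier G" by auto
    define L where "L = {p \<in> K. \<forall>r\<in>R'. fst p r = snd p r}"
    have LZ: "L \<subseteq> topspace ?Z \<times> topspace ?Z" using closedin_subset[OF K(1)] by (auto simp: L_def)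
    have "closedin (prod_topology ?Z ?Z) {p \<in> topspace (prod_topology ?Z ?Z). fst p r = snd p r}"
      if "r \<in> R'" for r
      using that R' continuous_map_compose[OF continuous_map_fst[of ?Z ?Z] continuous_map_evaluation[of r]]
        continuous_map_compose[OF continuous_map_snd[of ?Z ?Z] continuous_map_evaluation[of r]]
      by (intro closedin_continuous_maps_eq[OF S.Hausdorff]) (auto simp: o_def)
    then have Int: "closedin (prod_topology ?Z ?Z)
        (\<Inter>(insert K ((\<lambda>r. {p \<in> topspace (prod_topology ?Z ?Z). fst p r = snd p r}) ` R')))"
      using K(1) by (intro closedin_Inter) auto
    have "\<Inter>(insert K ((\<lambda>r. {p \<in> topspace (prod_topology ?Z ?Z). fst p r = snd p r}) ` R')) = L"
      using closedin_subset[OF K(1)] unfolding L_def by auto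
    then have L: "closedin (prod_topology ?Z ?Z) L" using Int by (simp only:)
    \<comment> \<open>Passing to \<open>L\<close> leaves invariance under \<open>N\<close>: both
      values at \<open>r\<close> are moved by the same
      \<open>\<phi> (r \<otimes> n \<otimes> inv r)\<close>, so agreement at \<open>r\<close>
      persists.\<close>
    have inv_L: "invariant_on N ?a L"
      unfolding invariant_on_def
    proof (intro ballI subsetI)
      fix n q assume n: "n \<in> N" and "q \<in> ?a n ` L"
      then obtain p where p: "p \<in> L" "q = ?a n p" by (auto simp only: image_iff)
      have "q \<in> K" using K(3) n NG p by (auto simp: invariant_on_def L_def)
      moreover have "fst q r = snd q r" if "r \<in> R'" for r
      proof -
        have "fst p \<in> topspace ?Z" "snd p \<in> topspace ?Z" using p(1) LZ by auto
        moreover have "fst p r = snd p r" using p(1) that by (simp add: L_def)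
        moreover have "r \<in> carrier G" using that R' by blast
        ultimately show ?thesis unfolding p(2) by (simp add: ev_action[OF n] map_prod_def split_beta)
      qed
      ultimately show "q \<in> L" by (simp add: L_def)
    qed
    have "closedin (prod_topology X X) (?ev g ` L)"
      by (intro compactin_imp_closedin[OF S.square_Hausdorff] image_compactin[OF _ cont_ev[OF g]]
          closedin_compact_space[OF Z.square_compact L])
    moreover have "invariant_on N (\<lambda>h. map_prod (\<phi> h) (\<phi> h)) (?ev g ` L)"
      unfolding invariant_on_def
    proof (intro ballI subsetI)
      fix n q assume n: "n \<in> N" and "q \<in> map_prod (\<phi> n) (\<phi> n) ` ?ev g ` L"
      then obtain p where p: "p \<in> L" "q = map_prod (\<phi> n) (\<phi> n) (?ev g p)"
        unfolding image_image by (elim imageE) (rule that)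
      have nG: "n \<in> carrier G" using n NG by blast
      \<comment> \<open>Chosen so that the twist at \<open>g\<close> gives back
        \<open>n\<close>.\<close>
      have m: "inv g \<otimes> n \<otimes> g \<in> N" using conj[of "inv g" n] g n by simp
      have "g \<otimes> (inv g \<otimes> n \<otimes> g) = n \<otimes> g" using g nG by (simp add: m_assoc[symmetric])
      then have "g \<otimes> (inv g \<otimes> n \<otimes> g) \<otimes> inv g = n" using g nG by (simp add: m_assoc)
      then have "coinduced_action (inv g \<otimes> n \<otimes> g) f g = \<phi> n (f g)" if "f \<in> topspace ?Z" for f
        using ev_action[OF m g that] by simp
      moreover have "fst p \<in> topspace ?Z" "snd p \<in> topspace ?Z" using p(1) LZ by auto
      ultimately have "q = ?ev g (?a (inv g \<otimes> n \<otimes> g) p)"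
        unfolding p(2) by (simp add: map_prod_def split_beta)
      moreover have "?a (inv g \<otimes> n \<otimes> g) p \<in> L" using inv_L m p(1) by (auto simp: invariant_on_def)
      ultimately show "q \<in> ?ev g ` L" by blast
    qed
    moreover have "?ev g ` L \<noteq> {}"
      using insert.IH[OF R'] unfolding L_def image_is_empty by blast
    ultimately have "\<exists>z. (z, z) \<in> ?ev g ` L" using prox unfolding proximal_on_def by blast
    then obtain p where "p \<in> L" "fst p g = snd p g" by auto
    then show ?case by (auto simp: L_def)
  qed
  from this[OF R(1,2)] obtain p where p: "p \<in> K" "\<forall>r\<in>R. fst p r = snd p r" by (elim bexE)
  define a b where "a = fst p" and "b = snd p"
  have ab: "(a, b) \<in> K" "\<And>r. r \<in> R \<Longrightarrow> a r = b r" using p by (simp_all add: a_def b_def)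
  then have abZ: "a \<in> topspace ?Z" "b \<in> topspace ?Z" using closedin_subset[OF K(1)] by auto
  have "a = b"
  proof
    fix g show "a g = b g"
    proof (cases "g \<in> carrier G")
      case True
      then obtain s r where "s \<in> S" "r \<in> R" "g = s \<otimes> r" using R(3) by blast
      moreover from this have "r \<in> carrier G" using R(2) by blast
      ultimately show ?thesis using abZ ab(2)[of r] by (simp add: coinduced_equivariant)
    next
      case False
      moreover have "a \<in> extensional (carrier G)" "b \<in> extensional (carrier G)"
        using abZ unfolding topspace_coinduced_iff PiE_def by blast+
      ultimately show ?thesis by (simp add: extensional_def)
    qed
  qed
  then show "\<exists>z. (z, z) \<in> K" using ab(1) by blast
qed

end

section \<open>Subgroups of finite index\<close>

lemma flow_map_comp:
  assumes "flow_map G X \<phi> Y \<psi> f" "flow_map G Y \<psi> Z \<zeta> g"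
  shows "flow_map G X \<phi> Z \<zeta> (g \<circ> f)"
  using assms continuous_map_image_subset_topspace[of X Y f] unfolding flow_map_def
  by (auto intro: continuous_map_compose)

text \<open>An equivariant map sends points fixed by \<open>t\<close> to points fixed by
  \<open>t\<close>.\<close>

lemma (in flow) free_flow_factor:
  assumes "flow_map G X \<phi> Y \<psi> f" "free_flow G T Y \<psi>"
  shows "free_flow G T X \<phi>"
proof (intro free_flow.intro free_flow_axioms.intro flow_axioms)
  interpret Y: free_flow G T Y \<psi> by fact
  fix x t assume xt: "x \<in> topspace X" "t \<in> carrier G" "t \<noteq> \<one>"
  then have "f x \<in> topspace Y"
    using assms(1) continuous_map_image_subset_topspace[of X Y f] by (auto simp: flow_map_def)
  then have "\<psi> t (f x) \<noteq> f x" using xt by (intro Y.free)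
  then show "\<phi> t x \<noteq> x" using xt assms(1) unfolding flow_map_def by metis
qed

text \<open>Both properties are established for the core and then pass up to \<open>S\<close>, since
  a larger acting set has fewer invariant sets.\<close>

lemma (in minimal_proximal_flow) restrict_finite_index:
  assumes "subgroup S G" "finite (rcosets S)"
  shows "minimal_proximal_flow (G\<lparr>carrier := S\<rparr>) (subtopology T S) X \<phi>"
proof -
  interpret S: flow "G\<lparr>carrier := S\<rparr>" "subtopology T S" X \<phi> by (rule subgroup_flow[OF assms(1)])
  obtain N C where N: "N \<subseteq> S" "\<And>g n. g \<in> carrier G \<Longrightarrow> n \<in> N \<Longrightarrow> g \<otimes> n \<otimes> inv g \<in> N"
    and C: "finite C" "C \<subseteq> carrier G" "\<And>g. g \<in> carrier G \<Longrightarrow> \<exists>c\<in>C. \<exists>n\<in>N. g = c \<otimes> n"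
    by (rule finite_index_core[OF assms]) (rule that)
  have NG: "N \<subseteq> carrier G" using N(1) subgroup.subset[OF assms(1)] by blast
  have min: "minimal_on (carrier G) X \<phi>" and prox: "proximal_on (carrier G) X \<phi>"
    using minimal_proximal_flow_iff minimal_proximal_flow_axioms by auto
  have "proximal_on N X \<phi>" by (rule proximal_on_finite_index[OF prox NG C])
  moreover from this have "minimal_on N X \<phi>" by (rule minimal_on_normal[OF min _ NG N(2)])
  ultimately show ?thesis
    using N(1) by (auto simp: S.minimal_proximal_flow_iff intro: minimal_on_mono proximal_on_mono)
qed

lemma (in universal_minimal_proximal_flow) flow_map_to_finite_index:
  fixes Y :: "'c topology"
  assumes S: "subgroup S G" "closedin T S" "finite (rcosets S)"
    and Y: "minimal_proximal_flow (G\<lparr>carrier := S\<rparr>) (subtopology T S) Y \<psi>"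
  shows "\<exists>q. flow_map (G\<lparr>carrier := S\<rparr>) X \<phi> Y \<psi> q"
proof -
  interpret Y: minimal_proximal_flow "G\<lparr>carrier := S\<rparr>" "subtopology T S" Y \<psi> by fact
  interpret C: open_subgroup_flow G T S Y \<psi>
    by (intro open_subgroup_flow.intro open_subgroup_flow_axioms.intro topological_group_axioms
        Y.flow_axioms S(1) openin_finite_index_subgroup[OF S])
  interpret Z: flow G T C.coinduced_space C.coinduced_action by (rule C.coinduced_flow)
  obtain N C where N: "N \<subseteq> S" "\<And>g n. g \<in> carrier G \<Longrightarrow> n \<in> N \<Longrightarrow> g \<otimes> n \<otimes> inv g \<in> N"
    and C: "finite C" "C \<subseteq> carrier G" "\<And>g. g \<in> carrier G \<Longrightarrow> \<exists>c\<in>C. \<exists>n\<in>N. g = c \<otimes> n"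
    by (rule finite_index_core[OF S(1,3)]) (rule that)
  \<comment> \<open>Because \<open>N\<close> lies in \<open>S\<close>, a representative of an
    element of \<open>S\<close> lies in \<open>S\<close> too. Hence proximality of \<open>Y\<close>
    under \<open>S\<close> descends to \<open>N\<close>.\<close>
  have "\<exists>c\<in>C \<inter> S. \<exists>n\<in>N. s = c \<otimes> n" if s: "s \<in> S" for s
  proof -
    have "s \<in> carrier G" using s by simp
    then obtain c n where cn: "c \<in> C" "n \<in> N" "s = c \<otimes> n" using C(3) by blast
    have nS: "n \<in> S" and cG: "c \<in> carrier G" using cn(1,2) N(1) C(2) by blast+
    have "s \<otimes> inv n = c" using cn(3) nS cG by (simp add: m_assoc)
    then have "c \<in> S" using C.sub.m_closed[OF s C.sub.m_inv_closed[OF nS]] by simp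
    then show ?thesis using cn by blast
  qed
  then have "proximal_on N Y \<psi>"
    using Y.proximal_on_finite_index[of N "C \<inter> S"] Y.minimal_proximal_flow_iff Y N(1) C(1)
    by simp
  \<comment> \<open>\<open>C\<close> represents cosets \<open>c N\<close>; inverting turns them into
    \<open>N (inv c)\<close>, the side on which coinduced points are equivariant.\<close>
  moreover have "\<exists>s\<in>S. \<exists>r\<in>(\<lambda>c. inv c) ` C. g = s \<otimes> r" if g: "g \<in> carrier G" for g
  proof -
    obtain c n where cn: "c \<in> C" "n \<in> N" "inv g = c \<otimes> n" using C(3)[OF inv_closed[OF g]] by blast
    have nS: "n \<in> S" and cG: "c \<in> carrier G" using cn(1,2) N(1) C(2) by blast+
    have "g = inv (c \<otimes> n)" using g by (simp add: cn(3)[symmetric])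
    also have "\<dots> = inv n \<otimes> inv c" using nS cG by (simp add: inv_mult_group)
    finally show ?thesis using C.sub.m_inv_closed[OF nS] cn(1) by blast
  qed
  ultimately have "proximal_on (carrier G) C.coinduced_space C.coinduced_action"
    using N C(1,2) by (intro C.coinduced_proximal[where R = "(\<lambda>c. inv c) ` C"]) auto
  then obtain M where M: "M \<subseteq> topspace C.coinduced_space"
    "minimal_proximal_flow G T (subtopology C.coinduced_space M)
       (\<lambda>t. restrict (C.coinduced_action t) M)"
    by (rule Z.minimal_proximal_subflow)
  \<comment> \<open>The points of \<open>M\<close> are functions on \<open>G\<close>, so the
    universal property for arbitrary types is used here.\<close>
  obtain F where F: "flow_map G X \<phi> (subtopology C.coinduced_space M)
      (\<lambda>t. restrict (C.coinduced_action t) M) F"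
    using universal_any_type[OF M(2)] by blast
  have cF: "continuous_map X C.coinduced_space F" and FM: "\<And>x. x \<in> topspace X \<Longrightarrow> F x \<in> M"
    using F by (auto simp: flow_map_def continuous_map_in_subtopology)
  have "flow_map (G\<lparr>carrier := S\<rparr>) X \<phi> Y \<psi> (\<lambda>x. F x \<one>)"
    unfolding flow_map_def
  proof (intro conjI ballI)
    show "continuous_map X Y (\<lambda>x. F x \<one>)"
      using continuous_map_compose[OF cF C.continuous_map_evaluation[OF one_closed]]
      by (simp add: o_def)
    fix s x assume "s \<in> carrier (G\<lparr>carrier := S\<rparr>)" and x: "x \<in> topspace X"
    then have s: "s \<in> S" and sG: "s \<in> carrier G" by simp_all
    have Fx: "F x \<in> topspace C.coinduced_space" using FM[OF x] M(1) by blast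
    have "F (\<phi> s x) = C.coinduced_action s (F x)"
      using F sG x FM[OF x] by (simp add: flow_map_def)
    \<comment> \<open>At the unit, right translation by \<open>s\<close> and left multiplication by
      \<open>s\<close> coincide, which makes evaluation there equivariant.\<close>
    then have "F (\<phi> s x) \<one> = F x (s \<otimes> \<one>)"
      using C.coinduced_action_apply[OF Fx one_closed] sG by simp
    then show "F (\<phi> s x) \<one> = \<psi> s (F x \<one>)"
      using C.coinduced_equivariant[OF Fx s one_closed] by simp
  qed
  then show ?thesis by blast
qed

theorem theorem2p7:
  fixes G :: "('a, 'm) monoid_scheme" (structure)
    and T :: "'a topology" and S :: "'a set"
    and X :: "'b topology" and \<phi> :: "'a \<Rightarrow> 'b \<Rightarrow> 'b"
    and Y :: "'c topology" and \<psi> :: "'a \<Rightarrow> 'c \<Rightarrow> 'c"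
  assumes "topological_group G T"
    and "subgroup S G" and "closedin T S" and "finite (rcosets S)"
    and "universal_minimal_proximal_flow (G\<lparr>carrier := S\<rparr>) (subtopology T S) X \<phi>"
    and "universal_minimal_proximal_flow G T Y \<psi>"
  shows "\<exists>\<rho>. flow G T X \<rho> \<and> (\<forall>s\<in>S. \<forall>x\<in>topspace X. \<rho> s x = \<phi> s x) \<and>
    isomorphic_flows G Y \<psi> X \<rho> \<and>
    (free_flow G T Y \<psi> \<longleftrightarrow> free_flow G T X \<rho>)"
proof -
  let ?S = "G\<lparr>carrier := S\<rparr>"
  interpret X: universal_minimal_proximal_flow ?S "subtopology T S" X \<phi> by fact
  interpret Y: universal_minimal_proximal_flow G T Y \<psi> by fact
  interpret YS: minimal_proximal_flow ?S "subtopology T S" Y \<psi>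
    by (rule Y.restrict_finite_index[OF assms(2,4)])
  have SG: "S \<subseteq> carrier G" using subgroup.subset[OF assms(2)] .
  obtain q where q: "flow_map ?S Y \<psi> X \<phi> q"
    using Y.flow_map_to_finite_index[OF assms(2-4) X.minimal_proximal_flow_axioms] by blast
  obtain p where p: "flow_map ?S X \<phi> Y \<psi> p"
    using X.universal_any_type[OF YS.minimal_proximal_flow_axioms] by blast
  \<comment> \<open>The composites are endomorphisms of minimal proximal flows of the same group
    \<open>S\<close>, on \<open>X\<close> and on \<open>Y\<close>, so rigidity applies to
    each.\<close>
  have qp: "q (p x) = x" if "x \<in> topspace X" for x
    using X.flow_map_self_eq_id[OF flow_map_comp[OF p q] that] by simp
  have pq: "p (q y) = y" if "y \<in> topspace Y" for y
    using YS.flow_map_self_eq_id[OF flow_map_comp[OF q p] that] by simp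
  have hom: "homeomorphic_maps Y X q p"
    using p q pq qp by (simp add: homeomorphic_maps_def flow_map_def)
  obtain \<rho> where \<rho>: "minimal_proximal_flow G T X \<rho>" "flow_map G X \<rho> Y \<psi> p"
    using minimal_proximal_flow_transport[OF Y.minimal_proximal_flow_axioms hom] by blast
  interpret R: minimal_proximal_flow G T X \<rho> by (rule \<rho>(1))
  have pX: "p x \<in> topspace Y" if "x \<in> topspace X" for x
    using p that continuous_map_image_subset_topspace[of X Y p] by (auto simp: flow_map_def)
  have qY: "q y \<in> topspace X" if "y \<in> topspace Y" for y
    using q that continuous_map_image_subset_topspace[of Y X q] by (auto simp: flow_map_def)
  have \<rho>_eq: "\<rho> t x = q (\<psi> t (p x))" if "t \<in> carrier G" "x \<in> topspace X" for t x
    using \<rho>(2) that qp[of "\<rho> t x"] by (simp add: flow_map_def)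
  \<comment> \<open>For \<open>s\<close> in \<open>S\<close>, equivariance of \<open>p\<close> turns
    \<open>q (\<psi> s (p x))\<close> into \<open>q (p (\<phi> s x))\<close>.\<close>
  have ext: "\<rho> s x = \<phi> s x" if "s \<in> S" "x \<in> topspace X" for s x
    using \<rho>_eq[of s x] that SG p qp[of "\<phi> s x"] X.action_in[of s x] by (auto simp: flow_map_def)
  have q_map: "flow_map G Y \<psi> X \<rho> q"
    using q by (simp add: flow_map_def \<rho>_eq qY pq)
  have "homeomorphic_map Y X q" using hom by (simp add: homeomorphic_maps_map)
  with q_map have "isomorphic_flows G Y \<psi> X \<rho>" by (auto simp: isomorphic_flows_def)
  moreover have "free_flow G T Y \<psi> \<longleftrightarrow> free_flow G T X \<rho>"
    using Y.free_flow_factor[OF q_map] R.free_flow_factor[OF \<rho>(2)] by blast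
  ultimately show ?thesis using R.flow_axioms ext by blast
qed

end
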